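(* Let $A$ be a quasi-Hopf (super)algebra. Suppose $\theta=\sum_ia_i\otimes b_i\otimes c_i\in A^{\otimes3}$ obeys $$(1\otimes\Delta)\Delta(a)\cdot\theta=\theta\cdot(1\otimes\Delta)\Delta(a)\quad\text{for all }a\in A.$$ If $\xi\in A^*$ is an even invariant linear form, then $$C=\sum_ia_i\,\xi\big(b_i\beta S(c_i)\big)$$ is a central element. Similarly, if $\bar\theta=\sum_i\bar a_i\otimes\bar b_i\otimes\bar c_i\in A^{\otimes3}$ satisfies $$\bar\theta\cdot(\Delta\otimes1)\Delta(a)=(\Delta\otimes1)\Delta(a)\cdot\bar\theta\quad\text{for all }a\in A,$$ and $\bar\xi\in A^*$ is an even pseudo-invariant linear form, then $$\bar C=\sum_i\bar\xi\big(S(\bar a_i)\alpha\bar b_i\big)\,\bar c_i$$ is a central element.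
   Context: A quasi-Hopf (super)algebra $(A,\Delta,\epsilon,\Phi)$ is a unital associative $\mathbb Z_2$-graded algebra $A$ over a field $K$ (the ungraded case being $A$ concentrated in degree $0$; $[a]\in\mathbb Z_2$ is the degree of a homogeneous $a$; sign formulas are stated for homogeneous elements and extended linearly), with grading-preserving algebra homomorphisms $\epsilon:A\to K$, $\Delta:A\to A\otimes A$, an invertible homogeneous $\Phi\in A\otimes A\otimes A$, a graded algebra anti-homomorphism $S:A\to A$ (grading preserving, $S(ab)=(-1)^{[a][b]}S(b)S(a)$) and homogeneous $\alpha,\beta\in A$. Tensor products are multiplied by $(a\otimes b)(a'\otimes b')=(-1)^{[b][a']}aa'\otimes bb'$. Write $\Phi=\sum_\nu X_\nu\otimes Y_\nu\otimes Z_\nu$, $\Phi^{-1}=\sum_\nu\bar X_\nu\otimes\bar Y_\nu\otimes\bar Z_\nu$, $\Delta(a)=\sum a_{(1)}\otimes a_{(2)}$ (homogeneous components). The axioms are, for all $a\in A$: $(1\otimes\Delta)\Delta(a)=\Phi^{-1}(\Delta\otimes1)\Delta(a)\Phi$; $(\Delta\otimes1\otimes1)\Phi\cdot(1\otimes1\otimes\Delta)\Phi=(\Phi\otimes1)\cdot(1\otimes\Delta\otimes1)\Phi\cdot(1\otimes\Phi)$; $(\epsilon\otimes1)\Delta=1=(1\otimes\epsilon)\Delta$; $(1\otimes\epsilon\otimes1)\Phi=1$; $\sum S(a_{(1)})\alpha a_{(2)}=\epsilon(a)\alpha$; $\sum a_{(1)}\beta S(a_{(2)})=\epsilon(a)\beta$;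 $\sum\bar X_\nu\beta S(\bar Y_\nu)\alpha\bar Z_\nu=1$; $\sum S(X_\nu)\alpha Y_\nu\beta S(Z_\nu)=1$. These imply that $\Phi,\alpha,\beta$ are even. $A^*$ is the space of linear forms on $A$ with values in the ground field. A form $\xi\in A^*$ is even if $\xi(a)=0$ for all odd $a$. It is invariant if $\sum\xi\big(a_{(1)}bS(a_{(2)})\big)(-1)^{[b][a_{(2)}]}=\epsilon(a)\xi(b)$ for all $a,b\in A$, and pseudo-invariant if $\sum\xi\big(S(a_{(1)})ba_{(2)}\big)(-1)^{[b][a_{(1)}]}=\epsilon(a)\xi(b)$ for all $a,b\in A$. Central means commuting with every element of $A$. *)

theory Defs
  imports Complex_Main "HOL-Library.Poly_Mapping" "HOL-Library.Z2"
begin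

definition lin_extend ::
    "('k \<Rightarrow> 'v \<Rightarrow> 'v) \<Rightarrow> ('w \<Rightarrow> 'v) \<Rightarrow> ('w \<Rightarrow>\<^sub>0 'k::zero) \<Rightarrow> 'v::comm_monoid_add" where
  "lin_extend sc g x = (\<Sum>w\<in>Poly_Mapping.keys x. sc (Poly_Mapping.lookup x w) (g w))"

definition free_scale :: "'k::field \<Rightarrow> ('w \<Rightarrow>\<^sub>0 'k) \<Rightarrow> ('w \<Rightarrow>\<^sub>0 'k)" where
  "free_scale c x = Poly_Mapping.map ((*) c) x"

definition parity_sign :: "bit \<Rightarrow> 'k::field" where
  "parity_sign d = (if d = 1 then - 1 else 1)"

text \<open>
  The exponent of the sign in the product
  \<open>(a\<^sub>1 \<otimes> \<dots> \<otimes> a\<^sub>n) (b\<^sub>1 \<otimes> \<dots> \<otimes> b\<^sub>n) = \<plusminus> a\<^sub>1 b\<^sub>1 \<otimes> \<dots> \<otimes> a\<^sub>n b\<^sub>n\<close>, where \<open>p\<close> and \<open>q\<close>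
  list the degrees of the \<open>a\<^sub>i\<close> and of the \<open>b\<^sub>j\<close>: every \<open>b\<^sub>j\<close> is moved past the \<open>a\<^sub>i\<close> with \<open>j < i\<close>.
\<close>

definition koszul_exponent :: "bit list \<Rightarrow> bit list \<Rightarrow> bit" where
  "koszul_exponent p q = (\<Sum>i<length p. \<Sum>j<i. p ! i * q ! j)"

text \<open>
  A unital associative superalgebra over the field \<open>'k\<close> on the type \<open>'a\<close>; the degrees form
  the type \<open>bit\<close> of integers modulo 2.
\<close>

locale superalgebra = vector_space scale
  for scale :: "'k::field \<Rightarrow> 'a::ring_1 \<Rightarrow> 'a" +
  fixes grade :: "bit \<Rightarrow> 'a set"
  assumes scale_mult_left: "scale c (a * b) = scale c a * b"
    and scale_mult_right: "scale c (a * b) = a * scale c b"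
    and grade_subspace: "subspace (grade i)"
    and grade_span: "\<exists>x\<in>grade 0. \<exists>y\<in>grade 1. a = x + y"
    and grade_Int: "grade 0 \<inter> grade 1 = {0}"
    and grade_one: "1 \<in> grade 0"
    and grade_mult: "a \<in> grade i \<Longrightarrow> b \<in> grade j \<Longrightarrow> a * b \<in> grade (i + j)"
begin

definition component :: "bit \<Rightarrow> 'a \<Rightarrow> 'a" where
  "component i a = (THE x. x \<in> grade i \<and> a - x \<in> grade (i + 1))"

text \<open>
  Tensor powers. A word \<open>[a\<^sub>1, \<dots>, a\<^sub>n]\<close> stands for \<open>a\<^sub>1 \<otimes> \<dots> \<otimes> a\<^sub>n\<close>. The \<open>n\<close>-th tensor power
  is the free vector space on the words of length \<open>n\<close>, modulo the span of the multilinearity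
  relations; its elements are cosets. The relations for all lengths are divided out at once,
  which is harmless because each relation involves words of a single length only: the quotient
  is the direct sum of all tensor powers, and \<open>tensor_power n\<close> is its summand of degree \<open>n\<close>.
\<close>

definition multilinear_relations :: "('a list \<Rightarrow>\<^sub>0 'k) set" where
  "multilinear_relations =
     {Poly_Mapping.single (u @ (a + b) # v) 1
        - (Poly_Mapping.single (u @ a # v) 1 + Poly_Mapping.single (u @ b # v) 1) | u v a b. True}
     \<union> {Poly_Mapping.single (u @ scale c a # v) 1 - Poly_Mapping.single (u @ a # v) c | u v a c. True}"

definition null_tensors :: "('a list \<Rightarrow>\<^sub>0 'k) set" where
  "null_tensors = module.span free_scale multilinear_relations"

definition tclass :: "('a list \<Rightarrow>\<^sub>0 'k) \<Rightarrow> ('a list \<Rightarrow>\<^sub>0 'k) set" where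
  "tclass x = {y. y - x \<in> null_tensors}"

definition pure :: "'a list \<Rightarrow> ('a list \<Rightarrow>\<^sub>0 'k) set" where
  "pure w = tclass (Poly_Mapping.single w 1)"

definition tensor_power :: "nat \<Rightarrow> ('a list \<Rightarrow>\<^sub>0 'k) set set" where
  "tensor_power n = tclass ` {x. \<forall>w\<in>Poly_Mapping.keys x. length w = n}"

definition homogeneous_tensors :: "nat \<Rightarrow> bit \<Rightarrow> ('a list \<Rightarrow>\<^sub>0 'k) set set" where
  "homogeneous_tensors n i = tclass ` {x. \<forall>w\<in>Poly_Mapping.keys x.
     length w = n \<and> (\<exists>ds. list_all2 (\<lambda>a d. a \<in> grade d) w ds \<and> sum_list ds = i)}"

text \<open>
  All operations on tensors are linear or multilinear extensions from words, evaluated on a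
  representative of the coset. The functions of words that are extended are multilinear in
  the letters on each length (up to \<open>null_tensors\<close>), so that the choice of the representative
  does not matter. As a representative may contain words of other lengths, whose part
  is then a null tensor, the functions are put to 0 on the lengths that do not fit.
\<close>

definition rep :: "('a list \<Rightarrow>\<^sub>0 'k) set \<Rightarrow> ('a list \<Rightarrow>\<^sub>0 'k)" where
  "rep X = (SOME x. x \<in> X)"

definition tadd :: "('a list \<Rightarrow>\<^sub>0 'k) set \<Rightarrow> ('a list \<Rightarrow>\<^sub>0 'k) set \<Rightarrow> ('a list \<Rightarrow>\<^sub>0 'k) set" where
  "tadd X Y = tclass (rep X + rep Y)"

definition tscale :: "'k \<Rightarrow> ('a list \<Rightarrow>\<^sub>0 'k) set \<Rightarrow> ('a list \<Rightarrow>\<^sub>0 'k) set" where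
  "tscale c X = tclass (free_scale c (rep X))"

definition word_mult :: "'a list \<Rightarrow> 'a list \<Rightarrow> ('a list \<Rightarrow>\<^sub>0 'k)" where
  "word_mult u v = (if length u = length v then
     (\<Sum>p\<in>set (List.n_lists (length u) [0, 1]). \<Sum>q\<in>set (List.n_lists (length v) [0, 1]).
        Poly_Mapping.single
          (map2 (*) (map2 component p u) (map2 component q v))
          (parity_sign (koszul_exponent p q))) else 0)"

definition tmult :: "('a list \<Rightarrow>\<^sub>0 'k) set \<Rightarrow> ('a list \<Rightarrow>\<^sub>0 'k) set \<Rightarrow> ('a list \<Rightarrow>\<^sub>0 'k) set"
    (infixl \<open>\<odot>\<close> 70) where
  "X \<odot> Y = tclass (lin_extend free_scale
     (\<lambda>u. lin_extend free_scale (\<lambda>v. word_mult u v) (rep Y)) (rep X))"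

definition tprod :: "('a list \<Rightarrow>\<^sub>0 'k) set \<Rightarrow> ('a list \<Rightarrow>\<^sub>0 'k) set \<Rightarrow> ('a list \<Rightarrow>\<^sub>0 'k) set"
    (infixr \<open>\<otimes>\<close> 75) where
  "X \<otimes> Y = tclass (lin_extend free_scale
     (\<lambda>u. lin_extend free_scale (\<lambda>v. Poly_Mapping.single (u @ v) 1) (rep Y)) (rep X))"

text \<open>
  \<open>tapply i f\<close> is \<open>1 \<otimes> \<dots> \<otimes> f \<otimes> \<dots> \<otimes> 1\<close> with the even tensor-valued linear map \<open>f\<close> in the factor
  with index \<open>i\<close>, and \<open>tcontract i f\<close> the same for an even linear form \<open>f\<close>, where the factor
  \<open>'k\<close> is absorbed into the remaining ones. Factors are counted from 0.
\<close>

definition tapply :: "nat \<Rightarrow> ('a \<Rightarrow> ('a list \<Rightarrow>\<^sub>0 'k) set) \<Rightarrow> ('a list \<Rightarrow>\<^sub>0 'k) set \<Rightarrow> ('a list \<Rightarrow>\<^sub>0 'k) set" where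
  "tapply i f X = tclass (lin_extend free_scale
     (\<lambda>w. if i < length w then lin_extend free_scale
        (\<lambda>v. Poly_Mapping.single (take i w @ v @ drop (Suc i) w) 1) (rep (f (w ! i))) else 0) (rep X))"

definition tcontract :: "nat \<Rightarrow> ('a \<Rightarrow> 'k) \<Rightarrow> ('a list \<Rightarrow>\<^sub>0 'k) set \<Rightarrow> ('a list \<Rightarrow>\<^sub>0 'k) set" where
  "tcontract i f X = tclass (lin_extend free_scale
     (\<lambda>w. if i < length w then Poly_Mapping.single (take i w @ drop (Suc i) w) (f (w ! i)) else 0)
     (rep X))"

text \<open>
  \<open>tsum2 sc g X\<close> is \<open>\<Sum> g x y\<close> for \<open>X = \<Sum> x \<otimes> y\<close>, with \<open>g\<close> bilinear into a space with scalar
  multiplication \<open>sc\<close>.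
\<close>

definition tsum2 :: "('k \<Rightarrow> 'v \<Rightarrow> 'v) \<Rightarrow> ('a \<Rightarrow> 'a \<Rightarrow> 'v) \<Rightarrow> ('a list \<Rightarrow>\<^sub>0 'k) set \<Rightarrow> 'v::comm_monoid_add" where
  "tsum2 sc g X = lin_extend sc (\<lambda>w. case w of [x, y] \<Rightarrow> g x y | _ \<Rightarrow> 0) (rep X)"

definition tsum3 :: "('k \<Rightarrow> 'v \<Rightarrow> 'v) \<Rightarrow> ('a \<Rightarrow> 'a \<Rightarrow> 'a \<Rightarrow> 'v) \<Rightarrow> ('a list \<Rightarrow>\<^sub>0 'k) set \<Rightarrow> 'v::comm_monoid_add" where
  "tsum3 sc g X = lin_extend sc (\<lambda>w. case w of [x, y, z] \<Rightarrow> g x y z | _ \<Rightarrow> 0) (rep X)"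

definition tensor3 :: "'i set \<Rightarrow> ('i \<Rightarrow> 'a) \<Rightarrow> ('i \<Rightarrow> 'a) \<Rightarrow> ('i \<Rightarrow> 'a) \<Rightarrow> ('a list \<Rightarrow>\<^sub>0 'k) set" where
  "tensor3 I a b c = tclass (\<Sum>i\<in>I. Poly_Mapping.single [a i, b i, c i] 1)"

definition even_form :: "('a \<Rightarrow> 'k) \<Rightarrow> bool" where
  "even_form \<xi> \<longleftrightarrow> (\<forall>a\<in>grade 1. \<xi> a = 0)"

end

locale quasi_hopf_superalgebra = superalgebra scale grade
  for scale :: "'k::field \<Rightarrow> 'a::ring_1 \<Rightarrow> 'a" and grade :: "bit \<Rightarrow> 'a set" +
  fixes \<Delta> :: "'a \<Rightarrow> ('a list \<Rightarrow>\<^sub>0 'k) set"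
    and \<epsilon> :: "'a \<Rightarrow> 'k"
    and \<Phi> \<Phi>inv :: "('a list \<Rightarrow>\<^sub>0 'k) set"
    and S :: "'a \<Rightarrow> 'a"
    and \<alpha> \<beta> :: 'a
  assumes counit_linear: "Vector_Spaces.linear scale (*) \<epsilon>"
    and counit_mult: "\<epsilon> (a * b) = \<epsilon> a * \<epsilon> b"
    and counit_one: "\<epsilon> 1 = 1"
    and counit_even: "even_form \<epsilon>"
    and coproduct_add: "\<Delta> (a + b) = tadd (\<Delta> a) (\<Delta> b)"
    and coproduct_scale: "\<Delta> (scale c a) = tscale c (\<Delta> a)"
    and coproduct_mult: "\<Delta> (a * b) = \<Delta> a \<odot> \<Delta> b"
    and coproduct_one: "\<Delta> 1 = pure [1, 1]"
    and coproduct_in: "\<Delta> a \<in> tensor_power 2"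
    and coproduct_grade: "a \<in> grade i \<Longrightarrow> \<Delta> a \<in> homogeneous_tensors 2 i"
    and associator_homogeneous: "\<exists>i. \<Phi> \<in> homogeneous_tensors 3 i"
    and associator_inv_in: "\<Phi>inv \<in> tensor_power 3"
    and associator_right_inv: "\<Phi> \<odot> \<Phi>inv = pure [1, 1, 1]"
    and associator_left_inv: "\<Phi>inv \<odot> \<Phi> = pure [1, 1, 1]"
    and antipode_linear: "Vector_Spaces.linear scale scale S"
    and antipode_one: "S 1 = 1"
    and antipode_mult:
      "a \<in> grade i \<Longrightarrow> b \<in> grade j \<Longrightarrow> S (a * b) = scale (parity_sign (i * j)) (S b * S a)"
    and antipode_grade: "a \<in> grade i \<Longrightarrow> S a \<in> grade i"
    and alpha_homogeneous: "\<exists>i. \<alpha> \<in> grade i"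
    and beta_homogeneous: "\<exists>i. \<beta> \<in> grade i"
    and quasi_coassoc: "tapply 1 \<Delta> (\<Delta> a) = \<Phi>inv \<odot> tapply 0 \<Delta> (\<Delta> a) \<odot> \<Phi>"
    and pentagon:
      "tapply 0 \<Delta> \<Phi> \<odot> tapply 2 \<Delta> \<Phi> = (\<Phi> \<otimes> pure [1]) \<odot> tapply 1 \<Delta> \<Phi> \<odot> (pure [1] \<otimes> \<Phi>)"
    and counit_left: "tsum2 scale (\<lambda>x y. scale (\<epsilon> x) y) (\<Delta> a) = a"
    and counit_right: "tsum2 scale (\<lambda>x y. scale (\<epsilon> y) x) (\<Delta> a) = a"
    and counit_associator: "tcontract 1 \<epsilon> \<Phi> = pure [1, 1]"
    and antipode_left: "tsum2 scale (\<lambda>x y. S x * \<alpha> * y) (\<Delta> a) = scale (\<epsilon> a) \<alpha>"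
    and antipode_right: "tsum2 scale (\<lambda>x y. x * \<beta> * S y) (\<Delta> a) = scale (\<epsilon> a) \<beta>"
    and antipode_associator_inv: "tsum3 scale (\<lambda>x y z. x * \<beta> * S y * \<alpha> * z) \<Phi>inv = 1"
    and antipode_associator: "tsum3 scale (\<lambda>x y z. S x * \<alpha> * y * \<beta> * S z) \<Phi> = 1"
begin

text \<open>
  In the next two definitions \<open>i\<close> is the degree of \<open>b\<close>, and \<open>j\<close> the degree of \<open>a\<^bsub>(2)\<^esub>\<close>
  respectively of \<open>a\<^bsub>(1)\<^esub>\<close>.
\<close>

definition invariant_form :: "('a \<Rightarrow> 'k) \<Rightarrow> bool" where
  "invariant_form \<xi> \<longleftrightarrow> (\<forall>a b.
     tsum2 (*) (\<lambda>x y. \<Sum>i\<in>{0, 1}. \<Sum>j\<in>{0, 1}.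
       parity_sign (i * j) * \<xi> (x * component i b * S (component j y))) (\<Delta> a) = \<epsilon> a * \<xi> b)"

definition pseudo_invariant_form :: "('a \<Rightarrow> 'k) \<Rightarrow> bool" where
  "pseudo_invariant_form \<xi> \<longleftrightarrow> (\<forall>a b.
     tsum2 (*) (\<lambda>x y. \<Sum>i\<in>{0, 1}. \<Sum>j\<in>{0, 1}.
       parity_sign (i * j) * \<xi> (S (component j x) * component i b * y)) (\<Delta> a) = \<epsilon> a * \<xi> b)"

end

end

theory Submission
  imports Defs
begin

text \<open>
  Write \<open>\<Sum> p \<otimes> r \<otimes> s\<close> for \<open>(1 \<otimes> \<Delta>)\<Delta>(t)\<close>, where \<open>\<Delta>(t) = \<Sum> p \<otimes> q\<close> and \<open>\<Delta>(q) = \<Sum> r \<otimes> s\<close>, and consider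
  the linear map \<open>T (x \<otimes> y \<otimes> z) = \<xi>(y \<beta> S(z)) x\<close> on the third tensor power, so that \<open>C = T \<theta>\<close>.
  Both sides of \<open>(1 \<otimes> \<Delta>)\<Delta>(t) \<theta> = \<theta> (1 \<otimes> \<Delta>)\<Delta>(t)\<close> have the same image under \<open>T\<close>. For \<open>\<theta> = \<Sum> a \<otimes> b \<otimes> c\<close>,
  and up to signs, these images consist of

    \<^item> \<open>\<xi>(r b \<beta> S(s c)) p a = \<xi>(r (b \<beta> S(c)) S(s)) p a\<close>, which by the invariance of \<open>\<xi>\<close> sums up over \<open>r \<otimes> s\<close>
      to \<open>\<epsilon>(q) \<xi>(b \<beta> S(c)) p a\<close>, and then by the counit axiom to \<open>t C\<close>;

    \<^item> \<open>\<xi>(b r \<beta> S(c s)) a p = \<xi>(b (r \<beta> S(s)) S(c)) a p\<close>, which by the axiom for \<open>\<beta>\<close> sums up to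
      \<open>\<epsilon>(q) \<xi>(b \<beta> S(c)) a p\<close>, and then to \<open>C t\<close>.

  For a pseudo-invariant form the map \<open>x \<otimes> y \<otimes> z \<mapsto> \<xi>(S(x) \<alpha> y) z\<close> plays the same part.

  Two points need care. First, the signs. For homogeneous letters, the sign that remains after the
  rearrangements and after the use of the invariance has an exponent in which every summand is a
  multiple of \<open>[q]\<close> or of \<open>[b] + [c]\<close>. Summands of the first kind are harmless because \<open>\<epsilon>(q) = 0\<close> for odd \<open>q\<close>,
  those of the second kind because \<open>\<xi>\<close> and \<open>\<beta>\<close> are even, so that \<open>\<xi>(b \<beta> S(c)) = 0\<close> if \<open>[b] + [c]\<close> is odd. That \<open>\<beta>\<close>
  is even follows from the antipode axiom for \<open>\<Phi>\<close>, which forces \<open>\<epsilon>(\<beta>) \<noteq> 0\<close> (\<open>alpha_beta_even\<close>). The four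
  identities with their signs are \<open>right_pairing_coproduct_mult\<close>, \<open>right_pairing_mult_coproduct\<close>,
  \<open>left_pairing_mult_coproduct\<close> and \<open>left_pairing_coproduct_mult\<close>.

  Second, tensors are cosets, and all operations on them go through a chosen representative.
  The values of a linear map on a product or on an iterated coproduct are therefore computed by
  the universal property: a multilinear function of words vanishes on null tensors, so it may be
  evaluated on any representative (\<open>teval_tclass\<close>).
\<close>

section \<open>Linear extension from a basis\<close>

lemma lin_extend_eq_sum:
  assumes "vector_space sc" and "finite A" and "Poly_Mapping.keys x \<subseteq> A"
  shows "lin_extend sc g x = (\<Sum>w\<in>A. sc (Poly_Mapping.lookup x w) (g w))"
proof -
  interpret vector_space sc by fact
  show ?thesis
    unfolding lin_extend_def using assms(2,3)
    by (intro sum.mono_neutral_left) (auto simp: in_keys_iff)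
qed

lemma lookup_free_scale [simp]:
  "Poly_Mapping.lookup (free_scale c x) w = c * Poly_Mapping.lookup x w"
  by (simp add: free_scale_def Poly_Mapping.map.rep_eq when_def)

lemma vector_space_free_scale: "vector_space (free_scale :: 'k::field \<Rightarrow> ('w \<Rightarrow>\<^sub>0 'k) \<Rightarrow> _)"
  by unfold_locales (auto intro!: poly_mapping_eqI simp: lookup_add algebra_simps)

lemma linear_lin_extend:
  fixes sc :: "'k::field \<Rightarrow> 'v::ab_group_add \<Rightarrow> 'v" and g :: "'w \<Rightarrow> 'v"
  assumes "vector_space sc"
  shows "Vector_Spaces.linear free_scale sc (lin_extend sc g)"
proof -
  interpret vector_space sc by fact
  have "lin_extend sc g (x + y) = lin_extend sc g x + lin_extend sc g y" for x y :: "'w \<Rightarrow>\<^sub>0 'k"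
  proof -
    let ?A = "Poly_Mapping.keys x \<union> Poly_Mapping.keys y"
    have "lin_extend sc g z = (\<Sum>w\<in>?A. sc (Poly_Mapping.lookup z w) (g w))"
      if "z \<in> {x, y, x + y}" for z
      using that keys_add[of x y] by (intro lin_extend_eq_sum[OF assms]) auto
    then show ?thesis
      by (simp add: lookup_add scale_left_distrib sum.distrib)
  qed
  moreover have "lin_extend sc g (free_scale c x) = sc c (lin_extend sc g x)" for c and x :: "'w \<Rightarrow>\<^sub>0 'k"
  proof -
    have "lin_extend sc g (free_scale c x)
        = (\<Sum>w\<in>Poly_Mapping.keys x. sc (Poly_Mapping.lookup (free_scale c x) w) (g w))"
      by (intro lin_extend_eq_sum[OF assms]) (auto simp: in_keys_iff)
    then show ?thesis
      by (simp add: lin_extend_def scale_sum_right)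
  qed
  ultimately show ?thesis
    using assms vector_space_free_scale by (simp add: Vector_Spaces.linear_iff)
qed

context
  fixes sc :: "'k::field \<Rightarrow> 'v::ab_group_add \<Rightarrow> 'v"
  assumes sc: "vector_space sc"
begin

interpretation vector_space sc by (fact sc)

lemma lin_extend_add: "lin_extend sc g (x + y) = lin_extend sc g x + lin_extend sc g y"
  using linear_lin_extend[OF sc, of g] by (simp add: Vector_Spaces.linear_iff)

lemma lin_extend_free_scale: "lin_extend sc g (free_scale c x) = sc c (lin_extend sc g x)"
  using linear_lin_extend[OF sc, of g] by (simp add: Vector_Spaces.linear_iff)

lemma lin_extend_zero: "lin_extend sc g 0 = 0"
  by (simp add: lin_extend_def)

lemma lin_extend_diff: "lin_extend sc g (x - y) = lin_extend sc g x - lin_extend sc g y"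
  using lin_extend_add[of g "x - y" y] by (simp add: algebra_simps)

lemma lin_extend_sum: "lin_extend sc g (\<Sum>i\<in>I. x i) = (\<Sum>i\<in>I. lin_extend sc g (x i))"
  by (induction I rule: infinite_finite_induct) (simp_all add: lin_extend_add lin_extend_zero)

lemma lin_extend_single: "lin_extend sc g (Poly_Mapping.single w c) = sc c (g w)"
  by (simp add: lin_extend_def)

lemma lin_extend_compose:
  "lin_extend sc g (lin_extend free_scale h x) = lin_extend sc (\<lambda>w. lin_extend sc g (h w)) x"
  unfolding lin_extend_def[of free_scale] lin_extend_sum lin_extend_free_scale
  by (simp add: lin_extend_def)

lemma lin_extend_swap:
  "lin_extend sc (\<lambda>u. lin_extend sc (\<lambda>v. h u v) y) x = lin_extend sc (\<lambda>v. lin_extend sc (\<lambda>u. h u v) x) y"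
  unfolding lin_extend_def scale_sum_right
  by (subst sum.swap) (simp add: mult.commute)

end

lemma lin_extend_linear_image:
  assumes "Vector_Spaces.linear sc sc' L"
  shows "lin_extend sc' (\<lambda>w. L (g w)) x = L (lin_extend sc g x)"
proof -
  interpret Vector_Spaces.linear sc sc' L by fact
  show ?thesis by (simp add: lin_extend_def sum scale)
qed

lemma lin_extend_cong:
  "(\<And>w. w \<in> Poly_Mapping.keys x \<Longrightarrow> g w = h w) \<Longrightarrow> lin_extend sc g x = lin_extend sc h x"
  by (simp add: lin_extend_def)

section \<open>Multilinear functions of words\<close>

context superalgebra
begin

text \<open>
  Linearity in each letter, on words of every length at once; this matches the relations that
  \<^const>\<open>null_tensors\<close> divides out, which also involve words of every length. The values on words of
  different lengths are unrelated.
\<close>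

definition multilinear :: "('k \<Rightarrow> 'v \<Rightarrow> 'v) \<Rightarrow> ('a list \<Rightarrow> 'v::ab_group_add) \<Rightarrow> bool" where
  "multilinear sc F \<longleftrightarrow> (\<forall>u v. Vector_Spaces.linear scale sc (\<lambda>x. F (u @ x # v)))"

text \<open>
  For multilinear \<open>F\<close>, the value at \<open>X\<close> of the linear map on tensors that corresponds to \<open>F\<close> by the
  universal property of the tensor product.
\<close>

definition teval :: "('k \<Rightarrow> 'v \<Rightarrow> 'v) \<Rightarrow> ('a list \<Rightarrow> 'v) \<Rightarrow> ('a list \<Rightarrow>\<^sub>0 'k) set \<Rightarrow> 'v::ab_group_add" where
  "teval sc F X = lin_extend sc F (rep X)"

lemma multilinearD:
  assumes "multilinear sc F"
  shows "F (u @ (x + y) # v) = F (u @ x # v) + F (u @ y # v)"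
    and "F (u @ scale c x # v) = sc c (F (u @ x # v))"
    and "F (u @ 0 # v) = 0"
proof -
  interpret Vector_Spaces.linear scale sc "\<lambda>x. F (u @ x # v)"
    using assms by (simp add: multilinear_def)
  show "F (u @ (x + y) # v) = F (u @ x # v) + F (u @ y # v)"
    "F (u @ scale c x # v) = sc c (F (u @ x # v))" "F (u @ 0 # v) = 0"
    by (rule add scale zero)+
qed

lemma multilinear_vector_space: "multilinear sc F \<Longrightarrow> vector_space sc"
  by (auto simp: multilinear_def Vector_Spaces.linear_iff)

lemma multilinear_add3:
  assumes "multilinear sc F"
  shows "F [x + x', y, z] = F [x, y, z] + F [x', y, z]"
    and "F [x, y + y', z] = F [x, y, z] + F [x, y', z]"
    and "F [x, y, z + z'] = F [x, y, z] + F [x, y, z']"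
  using multilinearD(1)[OF assms, of "[]" _ _ "[y, z]"] multilinearD(1)[OF assms, of "[x]" _ _ "[z]"]
    multilinearD(1)[OF assms, of "[x, y]" _ _ "[]"] by simp_all

lemma multilinear_linear3:
  assumes "multilinear sc F"
  shows "Vector_Spaces.linear scale sc (\<lambda>x. F [x, y, z])"
    and "Vector_Spaces.linear scale sc (\<lambda>y. F [x, y, z])"
    and "Vector_Spaces.linear scale sc (\<lambda>z. F [x, y, z])"
  using assms[unfolded multilinear_def, rule_format, of "[]" "[y, z]"]
    assms[unfolded multilinear_def, rule_format, of "[x]" "[z]"]
    assms[unfolded multilinear_def, rule_format, of "[x, y]" "[]"] by simp_all

lemma linear_zero_map: "vector_space sc \<Longrightarrow> Vector_Spaces.linear scale sc (\<lambda>x. 0)"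
  by (simp add: Vector_Spaces.linear_iff vector_space_axioms module.scale_zero_right module_iff_vector_space)

lemma multilinear_pair:
  assumes "\<And>y. Vector_Spaces.linear scale sc (\<lambda>x. f x y)" and "\<And>x. Vector_Spaces.linear scale sc (f x)"
  shows "multilinear sc (\<lambda>w. case w of [x, y] \<Rightarrow> f x y | _ \<Rightarrow> 0)"
  unfolding multilinear_def
proof (intro allI)
  fix u v :: "'a list"
  have sc: "vector_space sc" using assms(1) by (auto simp: Vector_Spaces.linear_iff)
  consider y where "u = []" "v = [y]" | x where "u = [x]" "v = []" | "length u + length v \<noteq> 1"
    by (cases u rule: remdups_adj.cases; cases v rule: remdups_adj.cases) auto
  then show "Vector_Spaces.linear scale sc (\<lambda>x. case u @ x # v of [x, y] \<Rightarrow> f x y | _ \<Rightarrow> 0)"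
  proof cases
    case 3
    have "(case w of [x, y] \<Rightarrow> f x y | _ \<Rightarrow> 0) = 0" if "length w \<noteq> 2" for w
      using that by (auto split: list.split)
    then show ?thesis using 3 linear_zero_map[OF sc] by simp
  qed (simp_all add: assms)
qed

lemma multilinear_triple:
  assumes "\<And>y z. Vector_Spaces.linear scale sc (\<lambda>x. f x y z)"
    and "\<And>x z. Vector_Spaces.linear scale sc (\<lambda>y. f x y z)"
    and "\<And>x y. Vector_Spaces.linear scale sc (f x y)"
  shows "multilinear sc (\<lambda>w. case w of [x, y, z] \<Rightarrow> f x y z | _ \<Rightarrow> 0)"
  unfolding multilinear_def
proof (intro allI)
  fix u v :: "'a list"
  have sc: "vector_space sc" using assms(1) by (auto simp: Vector_Spaces.linear_iff)
  consider y z where "u = []" "v = [y, z]" | x z where "u = [x]" "v = [z]"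
    | x y where "u = [x, y]" "v = []" | "length u + length v \<noteq> 2"
    by (cases u rule: remdups_adj.cases; cases v rule: remdups_adj.cases) auto
  then show "Vector_Spaces.linear scale sc (\<lambda>x. case u @ x # v of [x, y, z] \<Rightarrow> f x y z | _ \<Rightarrow> 0)"
  proof cases
    case 4
    have "(case w of [x, y, z] \<Rightarrow> f x y z | _ \<Rightarrow> 0) = 0" if "length w \<noteq> 3" for w
      using that by (auto split: list.split)
    then show ?thesis using 4 linear_zero_map[OF sc] by simp
  qed (simp_all add: assms)
qed

lemma multilinear_lin_extend:
  assumes "vector_space sc" and "\<And>u. multilinear sc (\<lambda>v. h u v)"
  shows "multilinear sc (\<lambda>v. lin_extend sc (\<lambda>u. h u v) x)"
proof -
  interpret V: vector_space sc by fact
  interpret vector_space_pair scale sc ..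
  show ?thesis
    unfolding multilinear_def lin_extend_def
    using assms(2)
    by (auto intro!: linear_compose_sum linear_compose_scale_right simp: multilinear_def)
qed

text \<open>
  The universal property: the kernel of the linear extension of \<open>F\<close> is a subspace, and the two kinds of
  multilinearity relations lie in it.
\<close>

lemma lin_extend_null_tensors:
  assumes F: "multilinear sc F" and "x \<in> null_tensors"
  shows "lin_extend sc F x = 0"
proof -
  note sc = multilinear_vector_space[OF F]
  interpret V: vector_space sc by (fact sc)
  interpret free: vector_space "free_scale :: 'k \<Rightarrow> ('a list \<Rightarrow>\<^sub>0 'k) \<Rightarrow> _"
    by (fact vector_space_free_scale)
  have "free.subspace {x. lin_extend sc F x = 0}"
    by (auto simp: free.subspace_def lin_extend_zero[OF sc] lin_extend_add[OF sc] lin_extend_free_scale[OF sc])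
  moreover have "multilinear_relations \<subseteq> {x. lin_extend sc F x = 0}"
    by (auto simp: multilinear_relations_def lin_extend_diff[OF sc] lin_extend_add[OF sc]
        lin_extend_single[OF sc] multilinearD[OF F])
  ultimately have "free.span multilinear_relations \<subseteq> {x. lin_extend sc F x = 0}"
    by (simp add: free.span_minimal)
  then show ?thesis
    using assms(2) by (auto simp: null_tensors_def)
qed

lemma teval_tclass:
  assumes F: "multilinear sc F"
  shows "teval sc F (tclass x) = lin_extend sc F x"
proof -
  interpret free: vector_space "free_scale :: 'k \<Rightarrow> ('a list \<Rightarrow>\<^sub>0 'k) \<Rightarrow> _"
    by (fact vector_space_free_scale)
  have "x \<in> tclass x"
    by (simp add: tclass_def null_tensors_def free.span_zero)
  then have "rep (tclass x) \<in> tclass x"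
    unfolding rep_def by (rule someI)
  then have "lin_extend sc F (rep (tclass x) - x) = 0"
    by (intro lin_extend_null_tensors[OF F]) (simp add: tclass_def)
  then show ?thesis
    by (simp add: teval_def lin_extend_diff[OF multilinear_vector_space[OF F]])
qed

lemma teval_tadd:
  assumes F: "multilinear sc F"
  shows "teval sc F (tadd X Y) = teval sc F X + teval sc F Y"
  unfolding tadd_def teval_tclass[OF F]
  by (simp add: teval_def lin_extend_add[OF multilinear_vector_space[OF F]])

lemma teval_tscale:
  assumes F: "multilinear sc F"
  shows "teval sc F (tscale c X) = sc c (teval sc F X)"
  unfolding tscale_def teval_tclass[OF F]
  by (simp add: teval_def lin_extend_free_scale[OF multilinear_vector_space[OF F]])

lemma teval_tensor3:
  assumes F: "multilinear sc F"
  shows "teval sc F (tensor3 I a b c) = (\<Sum>i\<in>I. F [a i, b i, c i])"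
proof -
  note sc = multilinear_vector_space[OF F]
  interpret V: vector_space sc by (fact sc)
  show ?thesis
    by (simp add: tensor3_def teval_tclass[OF F] lin_extend_sum[OF sc] lin_extend_single[OF sc])
qed

lemma tsum2_eq_teval: "tsum2 sc f X = teval sc (\<lambda>w. case w of [x, y] \<Rightarrow> f x y | _ \<Rightarrow> 0) X"
  by (simp add: tsum2_def teval_def)

text \<open>
  A chosen representative may contain words whose length is not 2, but it can be exchanged for one
  that has only words of length 2, where \<open>F\<close> agrees with its restriction to pairs.
\<close>

lemma teval_tensor_power_2:
  assumes F: "multilinear sc F" and X: "X \<in> tensor_power 2"
  shows "teval sc F X = tsum2 sc (\<lambda>x y. F [x, y]) X"
proof -
  obtain x where x: "X = tclass x" "\<And>w. w \<in> Poly_Mapping.keys x \<Longrightarrow> length w = 2"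
    using X by (auto simp: tensor_power_def)
  have F2: "multilinear sc (\<lambda>w. case w of [x, y] \<Rightarrow> F [x, y] | _ \<Rightarrow> 0)"
  proof (rule multilinear_pair)
    show "Vector_Spaces.linear scale sc (\<lambda>x. F [x, y])" for y
      using F[unfolded multilinear_def, rule_format, of "[]" "[y]"] by simp
    show "Vector_Spaces.linear scale sc (\<lambda>y. F [x, y])" for x
      using F[unfolded multilinear_def, rule_format, of "[x]" "[]"] by simp
  qed
  show ?thesis
    unfolding tsum2_eq_teval x(1) teval_tclass[OF F] teval_tclass[OF F2]
    by (rule lin_extend_cong) (auto dest!: x(2) simp: numeral_2_eq_2 length_Suc_conv)
qed

text \<open>
  This reduces sums over a coproduct to homogeneous factors without splitting the coproduct into
  components: a homogeneous tensor has a representative whose words have homogeneous letters.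
\<close>

lemma tsum2_homogeneous_cong:
  assumes f: "\<And>y. Vector_Spaces.linear scale sc (\<lambda>x. f x y)" "\<And>x. Vector_Spaces.linear scale sc (f x)"
    and g: "\<And>y. Vector_Spaces.linear scale sc (\<lambda>x. g x y)" "\<And>x. Vector_Spaces.linear scale sc (g x)"
    and X: "X \<in> homogeneous_tensors 2 k"
    and eq: "\<And>i j x y. x \<in> grade i \<Longrightarrow> y \<in> grade j \<Longrightarrow> i + j = k \<Longrightarrow> f x y = g x y"
  shows "tsum2 sc f X = tsum2 sc g X"
proof -
  obtain x where x: "X = tclass x" "\<And>w. w \<in> Poly_Mapping.keys x \<Longrightarrow>
      length w = 2 \<and> (\<exists>ds. list_all2 (\<lambda>a d. a \<in> grade d) w ds \<and> sum_list ds = k)"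
    using X by (auto simp: homogeneous_tensors_def)
  show ?thesis
    unfolding tsum2_eq_teval x(1) teval_tclass[OF multilinear_pair[OF f]] teval_tclass[OF multilinear_pair[OF g]]
    by (rule lin_extend_cong)
      (auto dest!: x(2) simp: numeral_2_eq_2 length_Suc_conv list_all2_Cons1 eq)
qed

lemma tsum2_linear_image:
  assumes "Vector_Spaces.linear sc sc' L"
  shows "tsum2 sc' (\<lambda>x y. L (g x y)) X = L (tsum2 sc g X)"
proof -
  interpret Vector_Spaces.linear sc sc' L by fact
  show ?thesis
    unfolding tsum2_def lin_extend_linear_image[OF assms, symmetric]
    by (rule lin_extend_cong) (auto simp: zero split: list.split)
qed

lemma tsum2_add:
  assumes "vector_space sc"
  shows "tsum2 sc (\<lambda>x y. f x y + g x y) X = tsum2 sc f X + tsum2 sc g X"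
proof -
  interpret V: vector_space sc by fact
  show ?thesis
    unfolding tsum2_def lin_extend_def sum.distrib[symmetric]
    by (rule sum.cong) (auto simp: V.scale_right_distrib split: list.split)
qed

section \<open>Homogeneous components\<close>

lemma grade_add: "x \<in> grade i \<Longrightarrow> y \<in> grade i \<Longrightarrow> x + y \<in> grade i"
  using grade_subspace subspace_add by blast

lemma grade_inter: "x \<in> grade i \<Longrightarrow> x \<in> grade (i + 1) \<Longrightarrow> x = 0"
  using grade_Int by (cases i) auto

lemma component_eqI:
  assumes "x \<in> grade i" and "a - x \<in> grade (i + 1)"
  shows "component i a = x"
  unfolding component_def
proof (rule the_equality)
  fix y assume y: "y \<in> grade i \<and> a - y \<in> grade (i + 1)"
  have "y - x \<in> grade i"
    using y assms(1) grade_subspace subspace_diff by blast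
  moreover have "y - x = (a - x) - (a - y)" by simp
  then have "y - x \<in> grade (i + 1)"
    using y assms(2) grade_subspace subspace_diff by metis
  ultimately show "y = x"
    using grade_inter by fastforce
qed (use assms in simp)

lemma component_grade: "component i a \<in> grade i"
  and component_complement: "a - component i a \<in> grade (i + 1)"
proof -
  obtain x y where xy: "x \<in> grade 0" "y \<in> grade 1" "a = x + y"
    using grade_span by blast
  have "component i a = (if i = 0 then x else y)"
    using xy by (intro component_eqI) (cases i; simp)+
  then show "component i a \<in> grade i" "a - component i a \<in> grade (i + 1)"
    using xy by (cases i; simp)+
qed

lemma component_homogeneous:
  assumes "a \<in> grade j"
  shows "component i a = (if i = j then a else 0)"
  using assms subspace_0[OF grade_subspace] by (intro component_eqI) (cases i; cases j; simp)+

text \<open>The complement of a component is homogeneous of the other degree, so sums and multiples of components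
  satisfy the characterisation of the component of the sum or multiple.\<close>

lemma linear_component: "Vector_Spaces.linear scale scale (component i)"
proof -
  have "component i (a + b) = component i a + component i b" for a b
    using grade_add[OF component_complement component_complement, of a i b]
    by (intro component_eqI) (auto intro: grade_add component_grade simp: algebra_simps)
  moreover have "component i (scale c a) = scale c (component i a)" for c a
    using subspace_scale[OF grade_subspace component_complement, of c a i]
    by (intro component_eqI)
      (auto intro: subspace_scale[OF grade_subspace] component_grade simp: scale_right_diff_distrib)
  ultimately show ?thesis
    by (simp add: Vector_Spaces.linear_iff vector_space_axioms)
qed

lemma homogeneous_induct [case_names homogeneous add]:
  assumes "\<And>i x. x \<in> grade i \<Longrightarrow> P x" and "\<And>x y. P x \<Longrightarrow> P y \<Longrightarrow> P (x + y)"
  shows "P x"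
  using assms grade_span[of x] by blast

section \<open>The linear functions of a product and of a coproduct\<close>

lemma linear_component_mult:
  "Vector_Spaces.linear scale scale (\<lambda>x. component i x * y)"
  "Vector_Spaces.linear scale scale (\<lambda>x. y * component i x)"
  using linear_component[of i] unfolding Vector_Spaces.linear_iff
  by (auto simp: distrib_left distrib_right scale_mult_left[symmetric] scale_mult_right[symmetric])

lemma linear_word_slot:
  assumes "multilinear sc F" and "Vector_Spaces.linear scale scale f"
  shows "Vector_Spaces.linear scale sc (\<lambda>x. F (u @ f x # v))"
  using Vector_Spaces.linear_compose[OF assms(2), of sc "\<lambda>y. F (u @ y # v)"] assms(1)
  by (simp add: multilinear_def o_def)

lemma map2_append_Cons_right:
  assumes "length p = Suc (length u + length v)"
  shows "map2 f p (u @ x # v) = map2 f (take (length u) p) u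
    @ f (p ! length u) x # map2 f (drop (Suc (length u)) p) v"
  using assms by (subst id_take_nth_drop[of "length u" p]) simp_all

lemma map2_append_Cons_left:
  assumes "length p = Suc (length u + length v)"
  shows "map2 f (u @ x # v) p = map2 f u (take (length u) p)
    @ f x (p ! length u) # map2 f v (drop (Suc (length u)) p)"
  using assms by (subst id_take_nth_drop[of "length u" p]) simp_all

text \<open>
  The function of two words from which \<^term>\<open>teval sc F (X \<odot> Y)\<close> arises by linear extension in both.
\<close>

definition eval_mult :: "('k \<Rightarrow> 'v \<Rightarrow> 'v) \<Rightarrow> ('a list \<Rightarrow> 'v) \<Rightarrow> 'a list \<Rightarrow> 'a list \<Rightarrow> 'v::ab_group_add" where
  "eval_mult sc F u v = lin_extend sc F (word_mult u v)"

lemma set_degree_lists: "set (List.n_lists n [0, 1 :: bit]) = {p. length p = n}"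
  by (auto simp: set_n_lists)

lemma eval_mult_eq_sum:
  assumes sc: "vector_space sc"
  shows "eval_mult sc F u v = (if length u = length v then
     (\<Sum>p | length p = length u. \<Sum>q | length q = length v.
        sc (parity_sign (koszul_exponent p q)) (F (map2 (*) (map2 component p u) (map2 component q v))))
     else 0)"
  unfolding eval_mult_def word_mult_def set_degree_lists
  by (simp add: lin_extend_sum[OF sc] lin_extend_single[OF sc] lin_extend_zero[OF sc])

lemma multilinear_eval_mult:
  assumes F: "multilinear sc F"
  shows "multilinear sc (\<lambda>u. eval_mult sc F u v)" and "multilinear sc (eval_mult sc F u)"
proof -
  note sc = multilinear_vector_space[OF F]
  interpret V: vector_space sc by (fact sc)
  interpret vector_space_pair scale sc ..
  have left: "Vector_Spaces.linear scale sc (\<lambda>x. F (map2 (*) (map2 component p (u1 @ x # u2)) m))"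
    if "length p = length (u1 @ 0 # u2)" "length m = length (u1 @ 0 # u2)" for p u1 u2 m
    using that
    by (simp add: map2_append_Cons_right map2_append_Cons_left)
      (intro linear_word_slot[OF F] linear_component_mult)
  have right: "Vector_Spaces.linear scale sc (\<lambda>x. F (map2 (*) m (map2 component p (u1 @ x # u2))))"
    if "length p = length (u1 @ 0 # u2)" "length m = length (u1 @ 0 # u2)" for p u1 u2 m
    using that
    by (simp add: map2_append_Cons_right map2_append_Cons_left)
      (intro linear_word_slot[OF F] linear_component_mult)
  show "multilinear sc (\<lambda>u. eval_mult sc F u v)"
    unfolding multilinear_def
  proof (intro allI)
    fix u1 u2
    show "Vector_Spaces.linear scale sc (\<lambda>x. eval_mult sc F (u1 @ x # u2) v)"
    proof (cases "length (u1 @ 0 # u2) = length v")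
      case True
      then show ?thesis
        by (simp add: eval_mult_eq_sum[OF sc])
          (intro linear_compose_sum ballI linear_compose_scale_right left;
            simp)
    qed (simp add: eval_mult_eq_sum[OF sc] linear_zero_map[OF sc])
  qed
  show "multilinear sc (eval_mult sc F u)"
    unfolding multilinear_def
  proof (intro allI)
    fix u1 u2
    show "Vector_Spaces.linear scale sc (\<lambda>x. eval_mult sc F u (u1 @ x # u2))"
    proof (cases "length u = length (u1 @ 0 # u2)")
      case True
      then show ?thesis
        by (simp add: eval_mult_eq_sum[OF sc])
          (intro linear_compose_sum ballI linear_compose_scale_right right;
            simp)
    qed (simp add: eval_mult_eq_sum[OF sc] linear_zero_map[OF sc])
  qed
qed

lemma multilinear_zero_letter: "multilinear sc F \<Longrightarrow> 0 \<in> set w \<Longrightarrow> F w = 0"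
  by (auto dest!: split_list simp: multilinearD(3))

lemma map2_component_homogeneous:
  assumes "list_all2 (\<lambda>a d. a \<in> grade d) u ds"
  shows "map2 component ds u = u"
    and "length p = length u \<Longrightarrow> p \<noteq> ds \<Longrightarrow> \<exists>i<length u. map2 component p u ! i = 0"
proof -
  have len: "length ds = length u" and gr: "\<And>i. i < length u \<Longrightarrow> u ! i \<in> grade (ds ! i)"
    using assms by (auto simp: list_all2_conv_all_nth)
  show "map2 component ds u = u"
    using len by (intro nth_equalityI) (auto simp: component_homogeneous[OF gr])
  show "\<exists>i<length u. map2 component p u ! i = 0" if p: "length p = length u" "p \<noteq> ds"
  proof -
    obtain i where "i < length u" "p ! i \<noteq> ds ! i"
      using p len nth_equalityI[of p ds] by metis
    then show ?thesis
      using p by (auto simp: component_homogeneous[OF gr] intro!: exI[of _ i])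
  qed
qed

text \<open>
  In the sum over all degree lists that defines the product of words, only the list of the actual
  degrees contributes: for any other list some letter is replaced by its component in the wrong degree, which is 0.
\<close>

lemma eval_mult_homogeneous:
  assumes F: "multilinear sc F"
    and u: "list_all2 (\<lambda>a d. a \<in> grade d) u ds" and v: "list_all2 (\<lambda>a d. a \<in> grade d) v es"
    and len: "length u = length v"
  shows "eval_mult sc F u v = sc (parity_sign (koszul_exponent ds es)) (F (map2 (*) u v))"
proof -
  note sc = multilinear_vector_space[OF F]
  interpret V: vector_space sc by (fact sc)
  let ?N = "{p :: bit list. length p = length u}"
  let ?t = "\<lambda>p q. sc (parity_sign (koszul_exponent p q)) (F (map2 (*) (map2 component p u) (map2 component q v)))"
  have N: "finite ?N"
    unfolding set_degree_lists[symmetric] by simp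
  have vanish: "?t p q = 0"
    if p: "p \<in> ?N" and q: "q \<in> ?N" and ne: "p \<noteq> ds \<or> q \<noteq> es" for p q
  proof -
    have pq: "length p = length u" "length q = length v"
      using p q len by auto
    obtain i where i: "i < length u" "map2 component p u ! i = 0 \<or> map2 component q v ! i = 0"
      using ne map2_component_homogeneous(2)[OF u pq(1)] map2_component_homogeneous(2)[OF v pq(2)] len
      by metis
    let ?w = "map2 (*) (map2 component p u) (map2 component q v)"
    have "?w ! i = 0" "i < length ?w"
      using i pq len by auto
    then have "0 \<in> set ?w"
      by (metis nth_mem)
    then show ?thesis
      using multilinear_zero_letter[OF F] by simp
  qed
  have mem: "ds \<in> ?N" "es \<in> ?N"
    using u v len by (auto dest: list_all2_lengthD)
  have "eval_mult sc F u v = (\<Sum>p\<in>?N. \<Sum>q\<in>?N. ?t p q)"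
    using len by (simp add: eval_mult_eq_sum[OF sc])
  also have "\<dots> = (\<Sum>p\<in>{ds}. \<Sum>q\<in>?N. ?t p q)"
    using N mem by (intro sum.mono_neutral_right ballI sum.neutral vanish) auto
  also have "\<dots> = (\<Sum>p\<in>{ds}. \<Sum>q\<in>{es}. ?t p q)"
    using N mem by (intro sum.cong[OF refl] sum.mono_neutral_right ballI vanish) auto
  finally show ?thesis
    by (simp add: map2_component_homogeneous(1)[OF u] map2_component_homogeneous(1)[OF v])
qed

text \<open>
  The second form, with the sums interchanged, is the one that is needed when the right factor has an
  explicit representative.
\<close>

lemma teval_tmult:
  assumes F: "multilinear sc F"
  shows "teval sc F (X \<odot> Y) = teval sc (\<lambda>u. teval sc (eval_mult sc F u) Y) X"
    and "teval sc F (X \<odot> Y) = teval sc (\<lambda>v. teval sc (\<lambda>u. eval_mult sc F u v) X) Y"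
proof -
  note sc = multilinear_vector_space[OF F]
  show "teval sc F (X \<odot> Y) = teval sc (\<lambda>u. teval sc (eval_mult sc F u) Y) X"
    unfolding tmult_def teval_tclass[OF F]
    by (simp add: lin_extend_compose[OF sc] teval_def eval_mult_def[abs_def])
  then show "teval sc F (X \<odot> Y) = teval sc (\<lambda>v. teval sc (\<lambda>u. eval_mult sc F u v) X) Y"
    unfolding teval_def by (subst (asm) lin_extend_swap[OF sc])
qed

lemma teval_mult_tensor3:
  assumes F: "multilinear sc F"
  shows "teval sc F (X \<odot> tensor3 I a b c) = (\<Sum>i\<in>I. teval sc (\<lambda>u. eval_mult sc F u [a i, b i, c i]) X)"
    and "teval sc F (tensor3 I a b c \<odot> X) = (\<Sum>i\<in>I. teval sc (eval_mult sc F [a i, b i, c i]) X)"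
proof -
  note sc = multilinear_vector_space[OF F]
  have "multilinear sc (\<lambda>v. teval sc (\<lambda>u. eval_mult sc F u v) X)"
    unfolding teval_def by (intro multilinear_lin_extend sc multilinear_eval_mult(2)[OF F])
  then show "teval sc F (X \<odot> tensor3 I a b c) = (\<Sum>i\<in>I. teval sc (\<lambda>u. eval_mult sc F u [a i, b i, c i]) X)"
    unfolding teval_tmult(2)[OF F] by (rule teval_tensor3)
  have "multilinear sc (\<lambda>u. teval sc (eval_mult sc F u) X)"
    unfolding teval_def by (intro multilinear_lin_extend sc multilinear_eval_mult(1)[OF F])
  then show "teval sc F (tensor3 I a b c \<odot> X) = (\<Sum>i\<in>I. teval sc (eval_mult sc F [a i, b i, c i]) X)"
    unfolding teval_tmult(1)[OF F] by (rule teval_tensor3)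
qed

lemma teval_tapply:
  assumes F: "multilinear sc F"
  shows "teval sc F (tapply i f X)
    = teval sc (\<lambda>w. if i < length w
        then teval sc (\<lambda>v. F (take i w @ v @ drop (Suc i) w)) (f (w ! i)) else 0) X"
proof -
  note sc = multilinear_vector_space[OF F]
  interpret V: vector_space sc by (fact sc)
  show ?thesis
    unfolding tapply_def teval_tclass[OF F] lin_extend_compose[OF sc] unfolding teval_def
    by (rule lin_extend_cong)
      (simp add: lin_extend_compose[OF sc] lin_extend_single[OF sc] lin_extend_zero[OF sc])
qed

lemma multilinear_insert:
  assumes F: "multilinear sc F"
  shows "multilinear sc (\<lambda>v. F (u @ v @ u'))"
  unfolding multilinear_def
proof (intro allI)
  fix v v'
  show "Vector_Spaces.linear scale sc (\<lambda>x. F (u @ (v @ x # v') @ u'))"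
    using F[unfolded multilinear_def, rule_format, of "u @ v" "v' @ u'"] by simp
qed

text \<open>
  Putting \<open>f\<close> into slot \<open>i\<close> keeps multilinearity: in the letter at position \<open>i\<close> by the linearity of \<open>f\<close>, and in
  every other letter by the multilinearity of \<open>F\<close>.
\<close>

lemma multilinear_apply_slot:
  assumes F: "multilinear sc F"
    and f: "\<And>a b. f (a + b) = tadd (f a) (f b)" "\<And>c a. f (scale c a) = tscale c (f a)"
  shows "multilinear sc (\<lambda>w. if i < length w
    then teval sc (\<lambda>v. F (take i w @ v @ drop (Suc i) w)) (f (w ! i)) else 0)"
    (is "multilinear sc ?G")
  unfolding multilinear_def
proof (intro allI)
  fix u v :: "'a list"
  note sc = multilinear_vector_space[OF F]
  interpret V: vector_space sc by (fact sc)
  interpret vector_space_pair scale sc ..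
  have other: "Vector_Spaces.linear scale sc (\<lambda>x. teval sc (\<lambda>w. F (l w @ x # r w)) X)" for l r X
    unfolding teval_def lin_extend_def
    using F by (auto intro!: linear_compose_sum linear_compose_scale_right simp: multilinear_def)
  consider "i = length u" | "i < length u"
    | "length u < i" "i < length (u @ 0 # v)" | "i \<ge> length (u @ 0 # v)"
    by linarith
  then show "Vector_Spaces.linear scale sc (\<lambda>x. ?G (u @ x # v))"
  proof cases
    case 1
    then show ?thesis
      using multilinear_insert[OF F, of u v]
      by (simp add: Vector_Spaces.linear_iff vector_space_axioms sc f teval_tadd teval_tscale)
  next
    case 2
    then show ?thesis
      using other[of "\<lambda>w. take i u @ w @ drop (Suc i) u" "\<lambda>_. v"] by (simp add: nth_append)
  next
    case 3
    then obtain k where "i = Suc (length u + k)" "k < length v"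
      by (auto dest!: less_imp_Suc_add)
    then show ?thesis
      using other[of "\<lambda>_. u" "\<lambda>w. take k v @ w @ drop (Suc k) v"] by (simp add: nth_append)
  next
    case 4
    then show ?thesis by (simp add: linear_zero_map[OF sc])
  qed
qed

end

context quasi_hopf_superalgebra
begin

lemma teval_iterated_coproduct:
  assumes F: "multilinear sc F"
  shows "teval sc F (tapply 1 \<Delta> (\<Delta> x)) = tsum2 sc (\<lambda>p q. tsum2 sc (\<lambda>r s. F [p, r, s]) (\<Delta> q)) (\<Delta> x)"
    and "teval sc F (tapply 0 \<Delta> (\<Delta> x)) = tsum2 sc (\<lambda>q p. tsum2 sc (\<lambda>r s. F [r, s, p]) (\<Delta> q)) (\<Delta> x)"
proof -
  note slot = multilinear_apply_slot[OF F coproduct_add coproduct_scale]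
  have "teval sc (\<lambda>v. F ([p] @ v @ [])) (\<Delta> q) = tsum2 sc (\<lambda>r s. F [p, r, s]) (\<Delta> q)" for p q
    by (subst teval_tensor_power_2[OF multilinear_insert[OF F] coproduct_in]) simp
  then show "teval sc F (tapply 1 \<Delta> (\<Delta> x)) = tsum2 sc (\<lambda>p q. tsum2 sc (\<lambda>r s. F [p, r, s]) (\<Delta> q)) (\<Delta> x)"
    unfolding teval_tapply[OF F] teval_tensor_power_2[OF slot coproduct_in] by simp
  have "teval sc (\<lambda>v. F ([] @ v @ [p])) (\<Delta> q) = tsum2 sc (\<lambda>r s. F [r, s, p]) (\<Delta> q)" for p q
    by (subst teval_tensor_power_2[OF multilinear_insert[OF F] coproduct_in]) simp
  then show "teval sc F (tapply 0 \<Delta> (\<Delta> x)) = tsum2 sc (\<lambda>q p. tsum2 sc (\<lambda>r s. F [r, s, p]) (\<Delta> q)) (\<Delta> x)"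
    unfolding teval_tapply[OF F] teval_tensor_power_2[OF slot coproduct_in] by simp
qed

lemma tsum2_coproduct_add:
  assumes "\<And>y. Vector_Spaces.linear scale sc (\<lambda>x. f x y)" "\<And>x. Vector_Spaces.linear scale sc (f x)"
  shows "tsum2 sc f (\<Delta> (q + q')) = tsum2 sc f (\<Delta> q) + tsum2 sc f (\<Delta> q')"
  by (simp add: tsum2_eq_teval coproduct_add teval_tadd[OF multilinear_pair[OF assms]])

section \<open>Pairing the iterated coproduct with a form\<close>

text \<open>
  The counit is multiplicative, so applying it to the antipode axiom for \<open>\<Phi>\<close> writes 1 as a sum of
  multiples of \<open>\<epsilon>(\<alpha>) \<epsilon>(\<beta>)\<close>. Hence neither factor vanishes, whereas \<open>\<epsilon>\<close> vanishes on odd elements.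
\<close>

lemma alpha_beta_even: "\<alpha> \<in> grade 0" "\<beta> \<in> grade 0"
proof -
  interpret \<epsilon>: Vector_Spaces.linear scale "(*)" \<epsilon> by (fact counit_linear)
  have "\<epsilon> \<alpha> \<noteq> 0 \<and> \<epsilon> \<beta> \<noteq> 0"
  proof (rule ccontr)
    assume "\<not> ?thesis"
    then have "\<epsilon> (S x * \<alpha> * y * \<beta> * S z) = 0" for x y z
      by (auto simp: counit_mult)
    then have "\<epsilon> (case w of [x, y, z] \<Rightarrow> S x * \<alpha> * y * \<beta> * S z | _ \<Rightarrow> 0) = 0" for w
      by (auto split: list.split)
    then have "\<epsilon> (tsum3 scale (\<lambda>x y z. S x * \<alpha> * y * \<beta> * S z) \<Phi>) = 0"
      unfolding tsum3_def lin_extend_linear_image[OF counit_linear, symmetric] by (simp add: lin_extend_def)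
    then show False
      by (simp add: antipode_associator counit_one)
  qed
  then have "\<alpha> \<notin> grade 1" "\<beta> \<notin> grade 1"
    using counit_even by (auto simp: even_form_def)
  then show "\<alpha> \<in> grade 0" "\<beta> \<in> grade 0"
    using alpha_homogeneous beta_homogeneous by (metis bit.exhaust)+
qed

lemma antipode_add: "S (x + y) = S x + S y" and antipode_scale: "S (scale c x) = scale c (S x)"
  using antipode_linear by (simp_all add: Vector_Spaces.linear_iff)

text \<open>
  The functions of words that send \<open>\<theta>\<close> to \<open>C\<close> and \<open>\<theta>'\<close> to \<open>C'\<close>. The unpaired factor, which yields the central
  element, is the first one for the invariant form and the last one for the pseudo-invariant form.
\<close>

definition right_pairing :: "('a \<Rightarrow> 'k) \<Rightarrow> 'a list \<Rightarrow> 'a" where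
  "right_pairing \<xi> w = (case w of [x, y, z] \<Rightarrow> scale (\<xi> (y * \<beta> * S z)) x | _ \<Rightarrow> 0)"

definition left_pairing :: "('a \<Rightarrow> 'k) \<Rightarrow> 'a list \<Rightarrow> 'a" where
  "left_pairing \<xi> w = (case w of [x, y, z] \<Rightarrow> scale (\<xi> (S x * \<alpha> * y)) z | _ \<Rightarrow> 0)"

lemmas linear_simps = Vector_Spaces.linear_iff vector_space_axioms
  antipode_add antipode_scale distrib_left distrib_right
  scale_mult_left[symmetric] scale_mult_right[symmetric]
  scale_left_distrib scale_right_distrib scale_left_commute mult.left_commute

lemma linear_antipode_products:
  "Vector_Spaces.linear scale scale (\<lambda>x. x * c * S y)"
  "Vector_Spaces.linear scale scale (\<lambda>y. x * c * S y)"
  "Vector_Spaces.linear scale scale (\<lambda>x. S x * c * y)"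
  "Vector_Spaces.linear scale scale (\<lambda>y. S x * c * y)"
  by (simp_all add: linear_simps)

lemma multilinear_right_pairing:
  assumes "Vector_Spaces.linear scale (*) \<xi>"
  shows "multilinear scale (right_pairing \<xi>)"
  unfolding right_pairing_def[abs_def] using assms
  by (intro multilinear_triple) (simp_all add: linear_simps)

lemma multilinear_left_pairing:
  assumes "Vector_Spaces.linear scale (*) \<xi>"
  shows "multilinear scale (left_pairing \<xi>)"
  unfolding left_pairing_def[abs_def] using assms
  by (intro multilinear_triple) (simp_all add: linear_simps)

lemma koszul_exponent_triple: "koszul_exponent [d, e, f] [i, j, k] = e * i + (f * i + f * j)"
  by (simp only: koszul_exponent_def list.size add_Suc_right add_0_right sum.lessThan_Suc lessThan_0 sum.empty)
    simp

lemma parity_sign_add: "(parity_sign (i + j) :: 'k) = parity_sign i * parity_sign j"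
  by (cases i; cases j) (simp_all add: parity_sign_def)

lemma counit_odd: "x \<in> grade 1 \<Longrightarrow> \<epsilon> x = 0"
  using counit_even by (simp add: even_form_def)

text \<open>
  Signs make sense for homogeneous letters only. The identities to be proved below are additive in each
  of five elements, which reduces them to that case.
\<close>

lemma homogeneous_induct5 [case_names homogeneous add1 add2 add3 add4 add5]:
  assumes "\<And>i j k l m p q x y z. p \<in> grade i \<Longrightarrow> q \<in> grade j \<Longrightarrow> x \<in> grade k \<Longrightarrow> y \<in> grade l
      \<Longrightarrow> z \<in> grade m \<Longrightarrow> P p q x y z"
    and "\<And>p p' q x y z. P p q x y z \<Longrightarrow> P p' q x y z \<Longrightarrow> P (p + p') q x y z"
    and "\<And>p q q' x y z. P p q x y z \<Longrightarrow> P p q' x y z \<Longrightarrow> P p (q + q') x y z"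
    and "\<And>p q x x' y z. P p q x y z \<Longrightarrow> P p q x' y z \<Longrightarrow> P p q (x + x') y z"
    and "\<And>p q x y y' z. P p q x y z \<Longrightarrow> P p q x y' z \<Longrightarrow> P p q x (y + y') z"
    and "\<And>p q x y z z'. P p q x y z \<Longrightarrow> P p q x y z' \<Longrightarrow> P p q x y (z + z')"
  shows "P p q x y z"
proof -
  have "P p q x y z" if "p \<in> grade i" "q \<in> grade j" "x \<in> grade k" "y \<in> grade l" for i j k l p q x y z
    by (induction z rule: homogeneous_induct) (use assms(1,6) that in blast)+
  then have "P p q x y z" if "p \<in> grade i" "q \<in> grade j" "x \<in> grade k" for i j k p q x y z
    by (induction y rule: homogeneous_induct) (use assms(5) that in blast)+
  then have "P p q x y z" if "p \<in> grade i" "q \<in> grade j" for i j p q x y z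
    by (induction x rule: homogeneous_induct) (use assms(4) that in blast)+
  then have "P p q x y z" if "p \<in> grade i" for i p q x y z
    by (induction q rule: homogeneous_induct) (use assms(3) that in blast)+
  then show ?thesis
    by (induction p rule: homogeneous_induct) (use assms(2) in blast)+
qed

lemma linear_invariance_summand:
  assumes "Vector_Spaces.linear scale (*) \<xi>"
  shows "Vector_Spaces.linear scale (*) (\<lambda>x. \<Sum>i\<in>{0, 1}. \<Sum>j\<in>{0, 1}.
      parity_sign (i * j) * \<xi> (x * component i b * S (component j y)))"
    and "Vector_Spaces.linear scale (*) (\<lambda>y. \<Sum>i\<in>{0, 1}. \<Sum>j\<in>{0, 1}.
      parity_sign (i * j) * \<xi> (x * component i b * S (component j y)))"
    and "Vector_Spaces.linear scale (*) (\<lambda>x. \<Sum>i\<in>{0, 1}. \<Sum>j\<in>{0, 1}.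
      parity_sign (i * j) * \<xi> (S (component j x) * component i b * y))"
    and "Vector_Spaces.linear scale (*) (\<lambda>y. \<Sum>i\<in>{0, 1}. \<Sum>j\<in>{0, 1}.
      parity_sign (i * j) * \<xi> (S (component j x) * component i b * y))"
  using assms linear_component by (simp_all add: linear_simps)

text \<open>For homogeneous \<open>b\<close> and \<open>y\<close> the summands in the definitions of invariance and pseudo-invariance reduce
  to a single term, the one with the sign of the actual degrees.\<close>

lemma summand_homogeneous:
  assumes \<xi>: "Vector_Spaces.linear scale (*) \<xi>" and b: "b \<in> grade m" and y: "y \<in> grade n"
  shows "(\<Sum>i\<in>{0, 1}. \<Sum>j\<in>{0, 1}. parity_sign (i * j) * \<xi> (x * component i b * S (component j y)))
      = parity_sign (m * n) * \<xi> (x * b * S y)"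
    and "(\<Sum>i\<in>{0, 1}. \<Sum>j\<in>{0, 1}. parity_sign (i * j) * \<xi> (S (component j y) * component i b * x))
      = parity_sign (m * n) * \<xi> (S y * b * x)"
proof -
  interpret \<xi>: Vector_Spaces.linear scale "(*)" \<xi> by (fact \<xi>)
  interpret S: Vector_Spaces.linear scale scale S by (fact antipode_linear)
  show "(\<Sum>i\<in>{0, 1}. \<Sum>j\<in>{0, 1}. parity_sign (i * j) * \<xi> (x * component i b * S (component j y)))
      = parity_sign (m * n) * \<xi> (x * b * S y)"
    "(\<Sum>i\<in>{0, 1}. \<Sum>j\<in>{0, 1}. parity_sign (i * j) * \<xi> (S (component j y) * component i b * x))
      = parity_sign (m * n) * \<xi> (S y * b * x)"
    by (cases m; cases n; simp add: component_homogeneous[OF b] component_homogeneous[OF y] \<xi>.zero S.zero)+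
qed

text \<open>
  Since \<open>S\<close> reverses products, \<open>\<xi>(r y \<beta> S(s z))\<close> has, up to sign, the shape \<open>\<xi>(r b S(s))\<close> with \<open>b = y \<beta> S(z)\<close>, and invariance
  applies. The sign in the definition of invariance absorbs \<open>([y] + [z])[s]\<close>; what is left is \<open>[q][x]\<close>.
\<close>

lemma right_pairing_coproduct_mult:
  assumes \<xi>: "Vector_Spaces.linear scale (*) \<xi>" and inv: "invariant_form \<xi>"
  shows "tsum2 scale (\<lambda>r s. eval_mult scale (right_pairing \<xi>) [p, r, s] [x, y, z]) (\<Delta> q)
    = scale (\<epsilon> q * \<xi> (y * \<beta> * S z)) (p * x)"
proof -
  interpret \<xi>: Vector_Spaces.linear scale "(*)" \<xi> by (fact \<xi>)
  interpret \<epsilon>: Vector_Spaces.linear scale "(*)" \<epsilon> by (fact counit_linear)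
  let ?E = "eval_mult scale (right_pairing \<xi>)"
  note F = multilinear_right_pairing[OF \<xi>]
  note E = multilinear_eval_mult[OF F]
  note lin = multilinear_linear3(2,3)[OF E(1)]
  show ?thesis
  proof (induction p q x y z rule: homogeneous_induct5)
    case (homogeneous i k d e f p q x y z)
    let ?b = "y * \<beta> * S z"
    let ?Inv = "\<lambda>r s. \<Sum>i\<in>{0, 1}. \<Sum>j\<in>{0, 1}. parity_sign (i * j) * \<xi> (r * component i ?b * S (component j s))"
    let ?L = "\<lambda>t. scale (parity_sign (k * d) * t) (p * x)"
    have b: "?b \<in> grade (e + f)"
      using grade_mult[OF grade_mult[OF homogeneous(4) alpha_beta_even(2)] antipode_grade[OF homogeneous(5)]]
      by simp
    have L: "Vector_Spaces.linear (*) scale ?L"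
      using \<xi> by (simp add: Vector_Spaces.linear_iff vector_space_axioms distrib_left scale_left_distrib mult.left_commute)
    have "tsum2 scale (\<lambda>r s. ?E [p, r, s] [x, y, z]) (\<Delta> q) = tsum2 scale (\<lambda>r s. ?L (?Inv r s)) (\<Delta> q)"
    proof (rule tsum2_homogeneous_cong[OF lin _ _ coproduct_grade[OF homogeneous(2)]])
      fix g h r s
      assume r: "r \<in> grade g" and s: "s \<in> grade h" and gh: "g + h = k"
      have "?E [p, r, s] [x, y, z]
          = scale (parity_sign (g * d + (h * d + h * e))) (right_pairing \<xi> [p * x, r * y, s * z])"
        using eval_mult_homogeneous[OF F, of "[p, r, s]" "[i, g, h]" "[x, y, z]" "[d, e, f]"] homogeneous r s
        unfolding koszul_exponent_triple by simp
      also have "right_pairing \<xi> [p * x, r * y, s * z] = scale (parity_sign (h * f) * \<xi> (r * ?b * S s)) (p * x)"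
        by (simp add: right_pairing_def antipode_mult[OF s homogeneous(5)]
            scale_mult_right[symmetric] \<xi>.scale mult.assoc)
      also have "scale (parity_sign (g * d + (h * d + h * e))) (scale (parity_sign (h * f) * \<xi> (r * ?b * S s)) (p * x))
          = scale (parity_sign (g * d + (h * d + h * e)) * parity_sign (h * f) * \<xi> (r * ?b * S s)) (p * x)"
        by (simp only: scale_scale mult.assoc)
      also have "parity_sign (g * d + (h * d + h * e)) * parity_sign (h * f)
          = (parity_sign (k * d) * parity_sign ((e + f) * h) :: 'k)"
        unfolding parity_sign_add[symmetric] gh[symmetric] by (simp only: distrib_left distrib_right ac_simps)
      finally show "?E [p, r, s] [x, y, z] = ?L (?Inv r s)"
        by (subst summand_homogeneous(1)[OF \<xi> b s]) (simp only: scale_scale mult.assoc)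
    qed (use Vector_Spaces.linear_compose[OF linear_invariance_summand(1)[OF \<xi>] L]
        Vector_Spaces.linear_compose[OF linear_invariance_summand(2)[OF \<xi>] L] in \<open>simp_all only: o_def\<close>)
    also have "\<dots> = ?L (\<epsilon> q * \<xi> ?b)"
      using inv tsum2_linear_image[OF L, of ?Inv] by (simp only: invariant_form_def)
    also have "\<dots> = scale (\<epsilon> q * \<xi> ?b) (p * x)"
      using counit_odd[of q] homogeneous(2) by (cases k) (auto simp: parity_sign_def)
    finally show ?case .
  next
    case (add2 p q q' x y z)
    then show ?case
      by (simp add: tsum2_coproduct_add[OF lin] \<epsilon>.add distrib_right scale_left_distrib)
  qed (simp_all add: multilinear_add3[OF E(1)] multilinear_add3[OF E(2)] tsum2_add[OF vector_space_axioms]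
      \<xi>.add antipode_add distrib_left distrib_right scale_left_distrib scale_right_distrib)
qed

text \<open>
  Here \<open>S\<close> moves \<open>S(s)\<close> next to \<open>r \<beta>\<close>, so that the defining property of \<open>\<beta>\<close> applies inside \<open>\<xi>\<close>. The remaining sign
  has exponent \<open>([y] + [z])[p] + [z][q]\<close>; it is 1 unless \<open>\<epsilon>(q)\<close> or \<open>\<xi>(y \<beta> S(z))\<close> vanishes.
\<close>

lemma right_pairing_mult_coproduct:
  assumes \<xi>: "Vector_Spaces.linear scale (*) \<xi>" and even: "even_form \<xi>"
  shows "tsum2 scale (\<lambda>r s. eval_mult scale (right_pairing \<xi>) [x, y, z] [p, r, s]) (\<Delta> q)
    = scale (\<epsilon> q * \<xi> (y * \<beta> * S z)) (x * p)"
proof -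
  interpret \<xi>: Vector_Spaces.linear scale "(*)" \<xi> by (fact \<xi>)
  interpret \<epsilon>: Vector_Spaces.linear scale "(*)" \<epsilon> by (fact counit_linear)
  let ?E = "eval_mult scale (right_pairing \<xi>)"
  note F = multilinear_right_pairing[OF \<xi>]
  note E = multilinear_eval_mult[OF F]
  note lin = multilinear_linear3(2,3)[OF E(2)]
  show ?thesis
  proof (induction p q x y z rule: homogeneous_induct5)
    case (homogeneous i k d e f p q x y z)
    let ?b = "y * \<beta> * S z"
    let ?s = "parity_sign ((e + f) * i + f * k) :: 'k"
    let ?L = "\<lambda>t. scale (?s * \<xi> (y * t * S z)) (x * p)"
    have b: "?b \<in> grade (e + f)"
      using grade_mult[OF grade_mult[OF homogeneous(4) alpha_beta_even(2)] antipode_grade[OF homogeneous(5)]]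
      by simp
    have "Vector_Spaces.linear scale scale (\<lambda>t. scale (c * \<xi> (y * t * S z)) (x * p))" for c
      using \<xi> by (simp add: linear_simps)
    note L = this[of ?s]
    have "tsum2 scale (\<lambda>r s. ?E [x, y, z] [p, r, s]) (\<Delta> q) = tsum2 scale (\<lambda>r s. ?L (r * \<beta> * S s)) (\<Delta> q)"
    proof (rule tsum2_homogeneous_cong[OF lin _ _ coproduct_grade[OF homogeneous(2)]])
      fix g h r s
      assume r: "r \<in> grade g" and s: "s \<in> grade h" and gh: "g + h = k"
      have "?E [x, y, z] [p, r, s]
          = scale (parity_sign (e * i + (f * i + f * g))) (right_pairing \<xi> [x * p, y * r, z * s])"
        using eval_mult_homogeneous[OF F, of "[x, y, z]" "[d, e, f]" "[p, r, s]" "[i, g, h]"] homogeneous r s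
        unfolding koszul_exponent_triple by simp
      also have "right_pairing \<xi> [x * p, y * r, z * s] = scale (parity_sign (f * h) * \<xi> (y * (r * \<beta> * S s) * S z)) (x * p)"
        by (simp add: right_pairing_def antipode_mult[OF homogeneous(5) s]
            scale_mult_right[symmetric] \<xi>.scale mult.assoc)
      also have "scale (parity_sign (e * i + (f * i + f * g))) (scale (parity_sign (f * h) * \<xi> (y * (r * \<beta> * S s) * S z)) (x * p))
          = scale (parity_sign (e * i + (f * i + f * g)) * parity_sign (f * h) * \<xi> (y * (r * \<beta> * S s) * S z)) (x * p)"
        by (simp only: scale_scale mult.assoc)
      also have "parity_sign (e * i + (f * i + f * g)) * parity_sign (f * h)
          = ?s"
        unfolding parity_sign_add[symmetric] gh[symmetric] by (simp only: distrib_left distrib_right ac_simps)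
      finally show "?E [x, y, z] [p, r, s] = ?L (r * \<beta> * S s)" .
    qed (use Vector_Spaces.linear_compose[OF linear_antipode_products(1) L]
        Vector_Spaces.linear_compose[OF linear_antipode_products(2) L] in \<open>simp_all only: o_def\<close>)
    also have "\<dots> = ?L (scale (\<epsilon> q) \<beta>)"
      using tsum2_linear_image[OF L, of "\<lambda>r s. r * \<beta> * S s"] by (simp only: antipode_right)
    also have "\<dots> = scale (?s * (\<epsilon> q * \<xi> ?b)) (x * p)"
      by (simp add: scale_mult_left[symmetric] scale_mult_right[symmetric] \<xi>.scale)
    also have "\<dots> = scale (\<epsilon> q * \<xi> ?b) (x * p)"
    \<comment> \<open>In the first case both sides vanish, in the second one the sign is 1.\<close>
    proof (cases "k = 1 \<or> e + f = 1")
      case True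
      then have "\<epsilon> q * \<xi> ?b = 0"
        using counit_odd homogeneous(2) even b unfolding even_form_def by (metis mult_zero_left mult_zero_right)
      then show ?thesis by (simp only: mult_zero_right)
    next
      case False
      then have "(e + f) * i + f * k = 0"
        by (metis (full_types) bit.exhaust add_0 mult_zero_left mult_zero_right)
      then show ?thesis by (simp add: parity_sign_def)
    qed
    finally show ?case .
  next
    case (add2 p q q' x y z)
    then show ?case
      by (simp add: tsum2_coproduct_add[OF lin] \<epsilon>.add distrib_right scale_left_distrib)
  qed (simp_all add: multilinear_add3[OF E(1)] multilinear_add3[OF E(2)] tsum2_add[OF vector_space_axioms]
      \<xi>.add antipode_add distrib_left distrib_right scale_left_distrib scale_right_distrib)
qed

text \<open>
  The mirror image of \<open>right_pairing_coproduct_mult\<close>: now pseudo-invariance applies to \<open>\<xi>(S(r) b s)\<close> with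
  \<open>b = S(x) \<alpha> y\<close>, and since the coproduct is the right factor, the sign that is left is \<open>[z][q]\<close>.
\<close>

lemma left_pairing_mult_coproduct:
  assumes \<xi>: "Vector_Spaces.linear scale (*) \<xi>" and inv: "pseudo_invariant_form \<xi>"
  shows "tsum2 scale (\<lambda>r s. eval_mult scale (left_pairing \<xi>) [x, y, z] [r, s, p]) (\<Delta> q)
    = scale (\<epsilon> q * \<xi> (S x * \<alpha> * y)) (z * p)"
proof -
  interpret \<xi>: Vector_Spaces.linear scale "(*)" \<xi> by (fact \<xi>)
  interpret \<epsilon>: Vector_Spaces.linear scale "(*)" \<epsilon> by (fact counit_linear)
  let ?E = "eval_mult scale (left_pairing \<xi>)"
  note F = multilinear_left_pairing[OF \<xi>]
  note E = multilinear_eval_mult[OF F]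
  note lin = multilinear_linear3(1,2)[OF E(2)]
  show ?thesis
  proof (induction p q x y z rule: homogeneous_induct5)
    case (homogeneous i k d e f p q x y z)
    let ?b = "S x * \<alpha> * y"
    let ?Inv = "\<lambda>r s. \<Sum>i\<in>{0, 1}. \<Sum>j\<in>{0, 1}. parity_sign (i * j) * \<xi> (S (component j r) * component i ?b * s)"
    let ?L = "\<lambda>t. scale (parity_sign (f * k) * t) (z * p)"
    have b: "?b \<in> grade (d + e)"
      using grade_mult[OF grade_mult[OF antipode_grade[OF homogeneous(3)] alpha_beta_even(1)] homogeneous(4)]
      by simp
    have L: "Vector_Spaces.linear (*) scale ?L"
      using \<xi> by (simp add: Vector_Spaces.linear_iff vector_space_axioms distrib_left scale_left_distrib mult.left_commute)
    have "tsum2 scale (\<lambda>r s. ?E [x, y, z] [r, s, p]) (\<Delta> q) = tsum2 scale (\<lambda>r s. ?L (?Inv r s)) (\<Delta> q)"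
    proof (rule tsum2_homogeneous_cong[OF lin _ _ coproduct_grade[OF homogeneous(2)]])
      fix g h r s
      assume r: "r \<in> grade g" and s: "s \<in> grade h" and gh: "g + h = k"
      have "?E [x, y, z] [r, s, p]
          = scale (parity_sign (e * g + (f * g + f * h))) (left_pairing \<xi> [x * r, y * s, z * p])"
        using eval_mult_homogeneous[OF F, of "[x, y, z]" "[d, e, f]" "[r, s, p]" "[g, h, i]"] homogeneous r s
        unfolding koszul_exponent_triple by simp
      also have "left_pairing \<xi> [x * r, y * s, z * p] = scale (parity_sign (d * g) * \<xi> (S r * ?b * s)) (z * p)"
        by (simp add: left_pairing_def antipode_mult[OF homogeneous(3) r]
            scale_mult_left[symmetric] \<xi>.scale mult.assoc)
      also have "scale (parity_sign (e * g + (f * g + f * h))) (scale (parity_sign (d * g) * \<xi> (S r * ?b * s)) (z * p))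
          = scale (parity_sign (e * g + (f * g + f * h)) * parity_sign (d * g) * \<xi> (S r * ?b * s)) (z * p)"
        by (simp only: scale_scale mult.assoc)
      also have "parity_sign (e * g + (f * g + f * h)) * parity_sign (d * g)
          = (parity_sign (f * k) * parity_sign ((d + e) * g) :: 'k)"
        unfolding parity_sign_add[symmetric] gh[symmetric] by (simp only: distrib_left distrib_right ac_simps)
      finally show "?E [x, y, z] [r, s, p] = ?L (?Inv r s)"
        by (subst summand_homogeneous(2)[OF \<xi> b r]) (simp only: scale_scale mult.assoc)
    qed (use Vector_Spaces.linear_compose[OF linear_invariance_summand(3)[OF \<xi>] L]
        Vector_Spaces.linear_compose[OF linear_invariance_summand(4)[OF \<xi>] L] in \<open>simp_all only: o_def\<close>)
    also have "\<dots> = ?L (\<epsilon> q * \<xi> ?b)"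
      using inv tsum2_linear_image[OF L, of ?Inv] by (simp only: pseudo_invariant_form_def)
    also have "\<dots> = scale (\<epsilon> q * \<xi> ?b) (z * p)"
      using counit_odd[of q] homogeneous(2) by (cases k) (auto simp: parity_sign_def)
    finally show ?case .
  next
    case (add2 p q q' x y z)
    then show ?case
      by (simp add: tsum2_coproduct_add[OF lin] \<epsilon>.add distrib_right scale_left_distrib)
  qed (simp_all add: multilinear_add3[OF E(1)] multilinear_add3[OF E(2)] tsum2_add[OF vector_space_axioms]
      \<xi>.add antipode_add distrib_left distrib_right scale_left_distrib scale_right_distrib)
qed

text \<open>
  The mirror image of \<open>right_pairing_mult_coproduct\<close>, with the defining property of \<open>\<alpha>\<close> and the remaining
  exponent \<open>([x] + [y])[p] + [x][q]\<close>.
\<close>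

lemma left_pairing_coproduct_mult:
  assumes \<xi>: "Vector_Spaces.linear scale (*) \<xi>" and even: "even_form \<xi>"
  shows "tsum2 scale (\<lambda>r s. eval_mult scale (left_pairing \<xi>) [r, s, p] [x, y, z]) (\<Delta> q)
    = scale (\<epsilon> q * \<xi> (S x * \<alpha> * y)) (p * z)"
proof -
  interpret \<xi>: Vector_Spaces.linear scale "(*)" \<xi> by (fact \<xi>)
  interpret \<epsilon>: Vector_Spaces.linear scale "(*)" \<epsilon> by (fact counit_linear)
  let ?E = "eval_mult scale (left_pairing \<xi>)"
  note F = multilinear_left_pairing[OF \<xi>]
  note E = multilinear_eval_mult[OF F]
  note lin = multilinear_linear3(1,2)[OF E(1)]
  show ?thesis
  proof (induction p q x y z rule: homogeneous_induct5)
    case (homogeneous i k d e f p q x y z)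
    let ?b = "S x * \<alpha> * y"
    let ?s = "parity_sign ((d + e) * i + d * k) :: 'k"
    let ?L = "\<lambda>t. scale (?s * \<xi> (S x * t * y)) (p * z)"
    have b: "?b \<in> grade (d + e)"
      using grade_mult[OF grade_mult[OF antipode_grade[OF homogeneous(3)] alpha_beta_even(1)] homogeneous(4)]
      by simp
    have "Vector_Spaces.linear scale scale (\<lambda>t. scale (c * \<xi> (S x * t * y)) (p * z))" for c
      using \<xi> by (simp add: linear_simps)
    note L = this[of ?s]
    have "tsum2 scale (\<lambda>r s. ?E [r, s, p] [x, y, z]) (\<Delta> q) = tsum2 scale (\<lambda>r s. ?L (S r * \<alpha> * s)) (\<Delta> q)"
    proof (rule tsum2_homogeneous_cong[OF lin _ _ coproduct_grade[OF homogeneous(2)]])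
      fix g h r s
      assume r: "r \<in> grade g" and s: "s \<in> grade h" and gh: "g + h = k"
      have "?E [r, s, p] [x, y, z]
          = scale (parity_sign (h * d + (i * d + i * e))) (left_pairing \<xi> [r * x, s * y, p * z])"
        using eval_mult_homogeneous[OF F, of "[r, s, p]" "[g, h, i]" "[x, y, z]" "[d, e, f]"] homogeneous r s
        unfolding koszul_exponent_triple by simp
      also have "left_pairing \<xi> [r * x, s * y, p * z] = scale (parity_sign (g * d) * \<xi> (S x * (S r * \<alpha> * s) * y)) (p * z)"
        by (simp add: left_pairing_def antipode_mult[OF r homogeneous(3)]
            scale_mult_left[symmetric] \<xi>.scale mult.assoc)
      also have "scale (parity_sign (h * d + (i * d + i * e))) (scale (parity_sign (g * d) * \<xi> (S x * (S r * \<alpha> * s) * y)) (p * z))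
          = scale (parity_sign (h * d + (i * d + i * e)) * parity_sign (g * d) * \<xi> (S x * (S r * \<alpha> * s) * y)) (p * z)"
        by (simp only: scale_scale mult.assoc)
      also have "parity_sign (h * d + (i * d + i * e)) * parity_sign (g * d)
          = ?s"
        unfolding parity_sign_add[symmetric] gh[symmetric] by (simp only: distrib_left distrib_right ac_simps)
      finally show "?E [r, s, p] [x, y, z] = ?L (S r * \<alpha> * s)" .
    qed (use Vector_Spaces.linear_compose[OF linear_antipode_products(3) L]
        Vector_Spaces.linear_compose[OF linear_antipode_products(4) L] in \<open>simp_all only: o_def\<close>)
    also have "\<dots> = ?L (scale (\<epsilon> q) \<alpha>)"
      using tsum2_linear_image[OF L, of "\<lambda>r s. S r * \<alpha> * s"] by (simp only: antipode_left)
    also have "\<dots> = scale (?s * (\<epsilon> q * \<xi> ?b)) (p * z)"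
      by (simp add: scale_mult_left[symmetric] scale_mult_right[symmetric] \<xi>.scale)
    also have "\<dots> = scale (\<epsilon> q * \<xi> ?b) (p * z)"
    \<comment> \<open>In the first case both sides vanish, in the second one the sign is 1.\<close>
    proof (cases "k = 1 \<or> d + e = 1")
      case True
      then have "\<epsilon> q * \<xi> ?b = 0"
        using counit_odd homogeneous(2) even b unfolding even_form_def by (metis mult_zero_left mult_zero_right)
      then show ?thesis by (simp only: mult_zero_right)
    next
      case False
      then have "(d + e) * i + d * k = 0"
        by (metis (full_types) bit.exhaust add_0 mult_zero_left mult_zero_right)
      then show ?thesis by (simp add: parity_sign_def)
    qed
    finally show ?case .
  next
    case (add2 p q q' x y z)
    then show ?case
      by (simp add: tsum2_coproduct_add[OF lin] \<epsilon>.add distrib_right scale_left_distrib)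
  qed (simp_all add: multilinear_add3[OF E(1)] multilinear_add3[OF E(2)] tsum2_add[OF vector_space_axioms]
      \<xi>.add antipode_add distrib_left distrib_right scale_left_distrib scale_right_distrib)
qed

section \<open>The central elements\<close>

lemma invariant_form_central:
  assumes \<xi>: "Vector_Spaces.linear scale (*) \<xi>" and even: "even_form \<xi>" and inv: "invariant_form \<xi>"
    and comm: "tapply 1 \<Delta> (\<Delta> x) \<odot> tensor3 I a b c = tensor3 I a b c \<odot> tapply 1 \<Delta> (\<Delta> x)"
  shows "(\<Sum>i\<in>I. scale (\<xi> (b i * \<beta> * S (c i))) (a i)) * x
    = x * (\<Sum>i\<in>I. scale (\<xi> (b i * \<beta> * S (c i))) (a i))"
proof -
  note F = multilinear_right_pairing[OF \<xi>]
  note E = multilinear_eval_mult[OF F]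
  let ?k = "\<lambda>i. \<xi> (b i * \<beta> * S (c i))"
  have L: "Vector_Spaces.linear scale scale (\<lambda>t. scale k (t * y))"
    "Vector_Spaces.linear scale scale (\<lambda>t. scale k (y * t))" for k y
    by (simp_all add: linear_simps)
  have "teval scale (right_pairing \<xi>) (tapply 1 \<Delta> (\<Delta> x) \<odot> tensor3 I a b c)
      = (\<Sum>i\<in>I. tsum2 scale (\<lambda>p q. scale (?k i) (scale (\<epsilon> q) p * a i)) (\<Delta> x))"
    unfolding teval_mult_tensor3[OF F] teval_iterated_coproduct[OF E(1)]
    by (simp add: right_pairing_coproduct_mult[OF \<xi> inv] scale_mult_left[symmetric] mult.commute)
  also have "\<dots> = x * (\<Sum>i\<in>I. scale (?k i) (a i))"
    by (simp only: tsum2_linear_image[OF L(1)] counit_right)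
      (simp add: sum_distrib_left scale_mult_right)
  finally have left: "teval scale (right_pairing \<xi>) (tapply 1 \<Delta> (\<Delta> x) \<odot> tensor3 I a b c)
      = x * (\<Sum>i\<in>I. scale (?k i) (a i))" .
  have "teval scale (right_pairing \<xi>) (tensor3 I a b c \<odot> tapply 1 \<Delta> (\<Delta> x))
      = (\<Sum>i\<in>I. tsum2 scale (\<lambda>p q. scale (?k i) (a i * scale (\<epsilon> q) p)) (\<Delta> x))"
    unfolding teval_mult_tensor3[OF F] teval_iterated_coproduct[OF E(2)]
    by (simp add: right_pairing_mult_coproduct[OF \<xi> even] scale_mult_right[symmetric] mult.commute)
  also have "\<dots> = (\<Sum>i\<in>I. scale (?k i) (a i)) * x"
    by (simp only: tsum2_linear_image[OF L(2)] counit_right)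
      (simp add: sum_distrib_right scale_mult_left)
  finally show ?thesis
    using left comm by simp
qed

lemma pseudo_invariant_form_central:
  assumes \<xi>: "Vector_Spaces.linear scale (*) \<xi>" and even: "even_form \<xi>" and inv: "pseudo_invariant_form \<xi>"
    and comm: "tensor3 I a b c \<odot> tapply 0 \<Delta> (\<Delta> x) = tapply 0 \<Delta> (\<Delta> x) \<odot> tensor3 I a b c"
  shows "(\<Sum>i\<in>I. scale (\<xi> (S (a i) * \<alpha> * b i)) (c i)) * x
    = x * (\<Sum>i\<in>I. scale (\<xi> (S (a i) * \<alpha> * b i)) (c i))"
proof -
  note F = multilinear_left_pairing[OF \<xi>]
  note E = multilinear_eval_mult[OF F]
  let ?k = "\<lambda>i. \<xi> (S (a i) * \<alpha> * b i)"
  have L: "Vector_Spaces.linear scale scale (\<lambda>t. scale k (t * y))"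
    "Vector_Spaces.linear scale scale (\<lambda>t. scale k (y * t))" for k y
    by (simp_all add: linear_simps)
  have "teval scale (left_pairing \<xi>) (tapply 0 \<Delta> (\<Delta> x) \<odot> tensor3 I a b c)
      = (\<Sum>i\<in>I. tsum2 scale (\<lambda>q p. scale (?k i) (scale (\<epsilon> q) p * c i)) (\<Delta> x))"
    unfolding teval_mult_tensor3[OF F] teval_iterated_coproduct[OF E(1)]
    by (simp add: left_pairing_coproduct_mult[OF \<xi> even] scale_mult_left[symmetric] mult.commute)
  also have "\<dots> = x * (\<Sum>i\<in>I. scale (?k i) (c i))"
    by (simp only: tsum2_linear_image[OF L(1)] counit_left)
      (simp add: sum_distrib_left scale_mult_right)
  finally have left: "teval scale (left_pairing \<xi>) (tapply 0 \<Delta> (\<Delta> x) \<odot> tensor3 I a b c)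
      = x * (\<Sum>i\<in>I. scale (?k i) (c i))" .
  have "teval scale (left_pairing \<xi>) (tensor3 I a b c \<odot> tapply 0 \<Delta> (\<Delta> x))
      = (\<Sum>i\<in>I. tsum2 scale (\<lambda>q p. scale (?k i) (c i * scale (\<epsilon> q) p)) (\<Delta> x))"
    unfolding teval_mult_tensor3[OF F] teval_iterated_coproduct[OF E(2)]
    by (simp add: left_pairing_mult_coproduct[OF \<xi> inv] scale_mult_right[symmetric] mult.commute)
  also have "\<dots> = (\<Sum>i\<in>I. scale (?k i) (c i)) * x"
    by (simp only: tsum2_linear_image[OF L(2)] counit_left)
      (simp add: sum_distrib_right scale_mult_left)
  finally show ?thesis
    using left comm by simp
qed

end

theorem proposition4:
  fixes scale :: "'k::field \<Rightarrow> 'a::ring_1 \<Rightarrow> 'a"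
    and grade :: "bit \<Rightarrow> 'a set"
    and \<Delta> :: "'a \<Rightarrow> ('a list \<Rightarrow>\<^sub>0 'k) set"
    and \<epsilon> :: "'a \<Rightarrow> 'k"
    and \<Phi> \<Phi>inv :: "('a list \<Rightarrow>\<^sub>0 'k) set"
    and S :: "'a \<Rightarrow> 'a"
    and \<alpha> \<beta> :: 'a
    and I :: "'i set" and a b c :: "'i \<Rightarrow> 'a" and \<xi> :: "'a \<Rightarrow> 'k"
    and J :: "'j set" and a' b' c' :: "'j \<Rightarrow> 'a" and \<xi>' :: "'a \<Rightarrow> 'k"
    and \<theta> \<theta>' :: "('a list \<Rightarrow>\<^sub>0 'k) set"
  assumes "quasi_hopf_superalgebra scale grade \<Delta> \<epsilon> \<Phi> \<Phi>inv S \<alpha> \<beta>"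
  shows "(finite I
      \<and> \<theta> = superalgebra.tensor3 scale I a b c
      \<and> (\<forall>x. superalgebra.tmult scale grade
                (superalgebra.tapply scale 1 \<Delta> (\<Delta> x)) \<theta>
            = superalgebra.tmult scale grade
                \<theta> (superalgebra.tapply scale 1 \<Delta> (\<Delta> x)))
      \<and> Vector_Spaces.linear scale (*) \<xi>
      \<and> superalgebra.even_form grade \<xi>
      \<and> quasi_hopf_superalgebra.invariant_form grade \<Delta> \<epsilon> S \<xi>
      \<longrightarrow> (\<forall>x. (\<Sum>i\<in>I. scale (\<xi> (b i * \<beta> * S (c i))) (a i)) * x
             = x * (\<Sum>i\<in>I. scale (\<xi> (b i * \<beta> * S (c i))) (a i))))
    \<and> (finite J
      \<and> \<theta>' = superalgebra.tensor3 scale J a' b' c'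
      \<and> (\<forall>x. superalgebra.tmult scale grade
                \<theta>' (superalgebra.tapply scale 0 \<Delta> (\<Delta> x))
            = superalgebra.tmult scale grade
                (superalgebra.tapply scale 0 \<Delta> (\<Delta> x)) \<theta>')
      \<and> Vector_Spaces.linear scale (*) \<xi>'
      \<and> superalgebra.even_form grade \<xi>'
      \<and> quasi_hopf_superalgebra.pseudo_invariant_form grade \<Delta> \<epsilon> S \<xi>'
      \<longrightarrow> (\<forall>x. (\<Sum>j\<in>J. scale (\<xi>' (S (a' j) * \<alpha> * b' j)) (c' j)) * x
             = x * (\<Sum>j\<in>J. scale (\<xi>' (S (a' j) * \<alpha> * b' j)) (c' j))))"
proof -
  interpret quasi_hopf_superalgebra scale grade \<Delta> \<epsilon> \<Phi> \<Phi>inv S \<alpha> \<beta>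
    by (fact assms)
  show ?thesis
    using invariant_form_central pseudo_invariant_form_central by blast
qed

end
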